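(* Let $Z_\infty=(X_\infty,Y_\infty)$ with $X_\infty(x,y)=(1,2\sin(2\pi x))$ for $y\ge0$, $Y_\infty(x,y)=(-1,2\sin(2\pi x))$ for $y\le0$, and $\Lambda_\infty=\{(x,\pm P_\infty(x)):x\in\mathbb{R}\}$ with $P_\infty(x)=\frac{1-\cos(2\pi x)}{\pi}$. Let $\widetilde Z$ be any planar PSVF presenting an $\infty$-homoclinic loop, and let $\widetilde\Lambda$ be the set formed by this loop. Then $Z_\infty$ restricted to $\Lambda_\infty$ and $\widetilde Z$ restricted to $\widetilde\Lambda$ are $\Sigma$-equivalent.
   Context: A planar PSVF $Z=(X,Y)$ with switching manifold $\Sigma=f^{-1}(0)$ ($f$ smooth, $0$ a regular value) equals the smooth field $X$ on $\Sigma^+=\{f\ge0\}$ and $Y$ on $\Sigma^-=\{f\le0\}$ (for $Z_\infty$, $f(x,y)=y$). With $Wf=\langle\nabla f,W\rangle$, $W^2f=\langle\nabla(Wf),W\rangle$: crossing points are $p\in\Sigma$ with $Xf(p)Yf(p)>0$; sliding region $\{Xf<0<Yf\}$, escaping $\{Yf<0<Xf\}$, with sliding field $Z^T=(Yf\,X-Xf\,Y)/(Yf-Xf)$. A point $p\in\Sigma$ is a fold of $X$ if $Xf(p)=0\neq X^2f(p)$, visible if $X^2f(p)>0$; a fold of $Y$ is visible if $Y^2f(p)<0$; a visible-visible two-fold is a visible fold of both. Trajectories follow the Filippov convention (off $\Sigma$ follow $X$ or $Y$; cross at crossing points; use $Z^T$ on sliding/escaping regions as usual; at a regular tangency choose any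 of $X,Y,Z^T$ backward and forward); a global trajectory is a bi-infinite orientation-preserving concatenation of local trajectories defined for all $t\in\mathbb{R}$. An $\infty$-homoclinic loop is a global trajectory presenting infinitely many visible-visible two-folds $p_1,p_2,\dots$ such that, after passing through $p_i$, the trajectory reaches $\Sigma$ either at $p_{i-1}$ or at $p_{i+1}$. $Z|_\Lambda$ and $\widetilde Z|_{\widetilde\Lambda}$ are $\Sigma$-equivalent if there is an orientation-preserving homeomorphism $h:\Lambda\to\widetilde\Lambda$ sending $\Lambda\cap\Sigma$ onto $\widetilde\Lambda\cap\widetilde\Sigma$, orbits of $X$ in $\Lambda\cap\Sigma^+$ onto orbits of $\widetilde X$ in $\widetilde\Lambda\cap\widetilde\Sigma^+$, orbits of $Y$ in $\Lambda\cap\Sigma^-$ onto orbits of $\widetilde Y$ in $\widetilde\Lambda\cap\widetilde\Sigma^-$, and orbits of $Z^T$ onto orbits of $\widetilde Z^T$.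
   Formalization: The loop is taken as distinct visible-visible two-folds p_i (i an integer) with X-arcs from p_i to p_{i+1} and Y-arcs from p_{i+1} to p_i, and its set as the union of all arcs; read literally, the claim fails for the trajectory of Z_∞ that follows only X. *)

theory Defs
  imports "HOL-Analysis.Analysis"
begin

type_synonym pt = "real \<times> real"

coinductive smooth2 :: "(pt \<Rightarrow> real) \<Rightarrow> bool" where
  smooth2I: "(\<And>z. (g has_derivative (\<lambda>v. fst v * gx z + snd v * gy z)) (at z))
     \<Longrightarrow> smooth2 gx \<Longrightarrow> smooth2 gy \<Longrightarrow> smooth2 g"

definition smooth_field :: "(pt \<Rightarrow> pt) \<Rightarrow> bool" where
  "smooth_field X \<longleftrightarrow> smooth2 (\<lambda>z. fst (X z)) \<and> smooth2 (\<lambda>z. snd (X z))"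

definition psvf :: "(pt \<Rightarrow> pt) \<Rightarrow> (pt \<Rightarrow> pt) \<Rightarrow> (pt \<Rightarrow> real) \<Rightarrow> bool" where
  "psvf X Y f \<longleftrightarrow> smooth_field X \<and> smooth_field Y \<and> smooth2 f \<and>
     (\<forall>z. f z = 0 \<longrightarrow> frechet_derivative f (at z) \<noteq> (\<lambda>v. 0))"

definition lie :: "(pt \<Rightarrow> real) \<Rightarrow> (pt \<Rightarrow> pt) \<Rightarrow> pt \<Rightarrow> real" where
  "lie f W z = frechet_derivative f (at z) (W z)"

definition lie2 :: "(pt \<Rightarrow> real) \<Rightarrow> (pt \<Rightarrow> pt) \<Rightarrow> pt \<Rightarrow> real" where
  "lie2 f W z = frechet_derivative (lie f W) (at z) (W z)"

definition visible_fold_X :: "(pt \<Rightarrow> pt) \<Rightarrow> (pt \<Rightarrow> real) \<Rightarrow> pt \<Rightarrow> bool" where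
  "visible_fold_X X f z \<longleftrightarrow> f z = 0 \<and> lie f X z = 0 \<and> lie2 f X z > 0"

definition visible_fold_Y :: "(pt \<Rightarrow> pt) \<Rightarrow> (pt \<Rightarrow> real) \<Rightarrow> pt \<Rightarrow> bool" where
  "visible_fold_Y Y f z \<longleftrightarrow> f z = 0 \<and> lie f Y z = 0 \<and> lie2 f Y z < 0"

definition vv_two_fold :: "(pt \<Rightarrow> pt) \<Rightarrow> (pt \<Rightarrow> pt) \<Rightarrow> (pt \<Rightarrow> real) \<Rightarrow> pt \<Rightarrow> bool" where
  "vv_two_fold X Y f z \<longleftrightarrow> visible_fold_X X f z \<and> visible_fold_Y Y f z"

definition sliding_or_escaping :: "(pt \<Rightarrow> pt) \<Rightarrow> (pt \<Rightarrow> pt) \<Rightarrow> (pt \<Rightarrow> real) \<Rightarrow> pt set" where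
  "sliding_or_escaping X Y f =
     {z. f z = 0 \<and> ((lie f X z < 0 \<and> 0 < lie f Y z) \<or> (lie f Y z < 0 \<and> 0 < lie f X z))}"

definition sliding_field :: "(pt \<Rightarrow> pt) \<Rightarrow> (pt \<Rightarrow> pt) \<Rightarrow> (pt \<Rightarrow> real) \<Rightarrow> pt \<Rightarrow> pt" where
  "sliding_field X Y f z =
     (1 / (lie f Y z - lie f X z)) *\<^sub>R (lie f Y z *\<^sub>R X z - lie f X z *\<^sub>R Y z)"

definition solves :: "(pt \<Rightarrow> pt) \<Rightarrow> (real \<Rightarrow> pt) \<Rightarrow> real \<Rightarrow> real \<Rightarrow> bool" where
  "solves W \<gamma> a b \<longleftrightarrow> (\<forall>s\<in>{a..b}. (\<gamma> has_vector_derivative W (\<gamma> s)) (at s within {a..b}))"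

definition xarc :: "(pt \<Rightarrow> pt) \<Rightarrow> (pt \<Rightarrow> real) \<Rightarrow> pt \<Rightarrow> pt \<Rightarrow> pt set" where
  "xarc X f p q = {z. \<exists>T \<gamma> s. T > 0 \<and> solves X \<gamma> 0 T \<and> \<gamma> 0 = p \<and> \<gamma> T = q \<and>
       (\<forall>u\<in>{0<..<T}. f (\<gamma> u) > 0) \<and> s \<in> {0..T} \<and> z = \<gamma> s}"

definition yarc :: "(pt \<Rightarrow> pt) \<Rightarrow> (pt \<Rightarrow> real) \<Rightarrow> pt \<Rightarrow> pt \<Rightarrow> pt set" where
  "yarc Y f p q = {z. \<exists>T \<gamma> s. T > 0 \<and> solves Y \<gamma> 0 T \<and> \<gamma> 0 = p \<and> \<gamma> T = q \<and>
       (\<forall>u\<in>{0<..<T}. f (\<gamma> u) < 0) \<and> s \<in> {0..T} \<and> z = \<gamma> s}"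

definition infty_homoclinic_loop ::
  "(pt \<Rightarrow> pt) \<Rightarrow> (pt \<Rightarrow> pt) \<Rightarrow> (pt \<Rightarrow> real) \<Rightarrow> (int \<Rightarrow> pt) \<Rightarrow> bool" where
  "infty_homoclinic_loop X Y f p \<longleftrightarrow> inj p \<and> (\<forall>i. vv_two_fold X Y f (p i)) \<and>
     (\<forall>i. xarc X f (p i) (p (i + 1)) \<noteq> {}) \<and> (\<forall>i. yarc Y f (p (i + 1)) (p i) \<noteq> {})"

definition loop_set :: "(pt \<Rightarrow> pt) \<Rightarrow> (pt \<Rightarrow> pt) \<Rightarrow> (pt \<Rightarrow> real) \<Rightarrow> (int \<Rightarrow> pt) \<Rightarrow> pt set" where
  "loop_set X Y f p = (\<Union>i. xarc X f (p i) (p (i + 1)) \<union> yarc Y f (p (i + 1)) (p i))"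

definition maps_orbits :: "(pt \<Rightarrow> pt) \<Rightarrow> pt set \<Rightarrow> (pt \<Rightarrow> pt) \<Rightarrow> pt set \<Rightarrow> (pt \<Rightarrow> pt) \<Rightarrow> bool" where
  "maps_orbits W A W' A' h \<longleftrightarrow>
     (\<forall>\<gamma> a b. a \<le> b \<and> solves W \<gamma> a b \<and> \<gamma> ` {a..b} \<subseteq> A \<longrightarrow>
        (\<exists>\<delta> c d \<tau>. c \<le> d \<and> solves W' \<delta> c d \<and> \<delta> ` {c..d} \<subseteq> A' \<and>
           strict_mono_on {a..b} \<tau> \<and> \<tau> ` {a..b} = {c..d} \<and>
           (\<forall>s\<in>{a..b}. h (\<gamma> s) = \<delta> (\<tau> s))))"

definition sigma_equiv ::
  "(pt \<Rightarrow> pt) \<Rightarrow> (pt \<Rightarrow> pt) \<Rightarrow> (pt \<Rightarrow> real) \<Rightarrow> pt set \<Rightarrow>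
   (pt \<Rightarrow> pt) \<Rightarrow> (pt \<Rightarrow> pt) \<Rightarrow> (pt \<Rightarrow> real) \<Rightarrow> pt set \<Rightarrow> bool" where
  "sigma_equiv X Y f L X' Y' f' L' \<longleftrightarrow>
     (\<exists>h g. homeomorphism L L' h g \<and>
        h ` (L \<inter> {z. f z = 0}) = L' \<inter> {z. f' z = 0} \<and>
        maps_orbits X (L \<inter> {z. f z \<ge> 0}) X' (L' \<inter> {z. f' z \<ge> 0}) h \<and>
        maps_orbits X' (L' \<inter> {z. f' z \<ge> 0}) X (L \<inter> {z. f z \<ge> 0}) g \<and>
        maps_orbits Y (L \<inter> {z. f z \<le> 0}) Y' (L' \<inter> {z. f' z \<le> 0}) h \<and>
        maps_orbits Y' (L' \<inter> {z. f' z \<le> 0}) Y (L \<inter> {z. f z \<le> 0}) g \<and>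
        maps_orbits (sliding_field X Y f) (L \<inter> sliding_or_escaping X Y f)
                    (sliding_field X' Y' f') (L' \<inter> sliding_or_escaping X' Y' f') h \<and>
        maps_orbits (sliding_field X' Y' f') (L' \<inter> sliding_or_escaping X' Y' f')
                    (sliding_field X Y f) (L \<inter> sliding_or_escaping X Y f) g)"

definition X_inf :: "pt \<Rightarrow> pt" where "X_inf z = (1, 2 * sin (2 * pi * fst z))"
definition Y_inf :: "pt \<Rightarrow> pt" where "Y_inf z = (-1, 2 * sin (2 * pi * fst z))"
definition f_inf :: "pt \<Rightarrow> real" where "f_inf z = snd z"
definition P_inf :: "real \<Rightarrow> real" where "P_inf x = (1 - cos (2 * pi * x)) / pi"
definition Lambda_inf :: "pt set" where
  "Lambda_inf = {(x, P_inf x) | x. True} \<union> {(x, - P_inf x) | x. True}"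

end

theory Submission
  imports Defs
begin

text \<open>The upper arcs of the loop concatenate to one injective orbit of \<open>X'\<close>, parametrized by an open
  interval, and the lower arcs to one injective orbit of \<open>Y'\<close>; they meet exactly in the two-folds.
  Matching these two orbits with the two graphs that form the model set, so that the two-folds
  correspond to the integers, gives a continuous bijection that respects orbits by uniqueness of
  solutions. Its inverse is continuous because an injective orbit of a planar field cannot accumulate
  on itself: as in the Poincare-Bendixson theorem, this follows from the Jordan curve theorem. No
  sliding or escaping points occur, since both fields are tangent to the switching manifold at the
  two-folds.\<close>

section \<open>Returns to a transversal\<close>

text \<open>The two-folds are only assumed distinct. They may accumulate in the plane and the flight
  times of the arcs may be summable, so an orbit may live on a bounded time interval and its later
  arcs could a priori come back close to earlier ones. Excluding this concerns one orbit of one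
  smooth field, so the orbits of \<open>X'\<close> and \<open>Y'\<close> are treated apart; the
  halves \<open>f' \<ge> 0\<close> and \<open>f' \<le> 0\<close> of the loop are pasted along their
  common zeros only at the end.

  Near a given point of an orbit, a translation and a complex division normalise the field to take
  the value \<open>1\<close> at \<open>0\<close>. Solutions then cross the imaginary axis near
  \<open>0\<close> from left to right only, which makes this axis a transversal. Because lifetimes
  may be finite, an orbit might also return by converging to its own starting point without crossing
  the axis; this case is excluded by gluing the solution to its limit.\<close>

lemma first_return_time:
  fixes \<phi> :: "real \<Rightarrow> 'a::metric_space"
  assumes cont: "continuous_on {a..b} \<phi>" and "closed K" and "a < b" "\<phi> b \<in> K"
    and "d > 0" and away: "\<And>h. 0 < h \<Longrightarrow> h < d \<Longrightarrow> \<phi> (a + h) \<notin> K"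
  obtains t where "a < t" "t \<le> b" "\<phi> t \<in> K" "\<And>s. a < s \<Longrightarrow> s < t \<Longrightarrow> \<phi> s \<notin> K"
proof -
  \<comment> \<open>Dropping the initial stretch of length \<open>d\<close> makes the set of hitting
    times compact, so that it has a least element, and this element is still beyond
    \<open>a\<close>.\<close>
  define S where "S = {a + d..b} \<inter> (\<phi> -` K \<inter> {a..b})"
  have "closed (\<phi> -` K \<inter> {a..b})"
    using continuous_on_closed_vimage[OF closed_atLeastAtMost, of a b \<phi>] cont \<open>closed K\<close> by blast
  then have "compact S" unfolding S_def by (simp add: compact_Int_closed)
  have ge: "a + d \<le> s" if "a < s" "\<phi> s \<in> K" for s
    using away[of "s - a"] that by force
  have "b \<in> S" using assms ge[of b] by (auto simp: S_def)
  then obtain t where t: "t \<in> S" "\<And>s. s \<in> S \<Longrightarrow> t \<le> s"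
    using compact_attains_inf[OF \<open>compact S\<close>] by blast
  show thesis
  proof
    show "a < t" "t \<le> b" "\<phi> t \<in> K" using t \<open>d > 0\<close> by (auto simp: S_def)
    show "\<phi> s \<notin> K" if "a < s" "s < t" for s
      using t(2)[of s] that ge[of s] \<open>t \<le> b\<close> by (force simp: S_def)
  qed
qed

lemma positive_derivative_at_zero:
  fixes u :: "real \<Rightarrow> real"
  assumes "(u has_real_derivative D) (at t)" "D > 0" "u t = 0"
  shows "\<exists>d>0. \<forall>h. 0 < h \<longrightarrow> h < d \<longrightarrow> u (t + h) > 0 \<and> u (t - h) < 0"
proof -
  obtain d1 where d1: "d1 > 0" "\<And>h. 0 < h \<Longrightarrow> h < d1 \<Longrightarrow> u t < u (t + h)"
    using DERIV_pos_inc_right[OF assms(1,2)] by blast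
  obtain d2 where d2: "d2 > 0" "\<And>h. 0 < h \<Longrightarrow> h < d2 \<Longrightarrow> u (t - h) < u t"
    using DERIV_pos_inc_left[OF assms(1,2)] by blast
  show ?thesis
    by (rule exI[of _ "min d1 d2"]) (use d1 d2 assms(3) in auto)
qed

text \<open>The Jordan curve formed by the orbit up to its first return to the transversal and by
  the piece of the transversal in between cannot be crossed again: the orbit would have to pass from
  the right to the left of that piece without meeting the curve, whereas both components of the
  complement accumulate at each point of the piece.\<close>

lemma no_returns_to_half_transversal:
  fixes \<phi> :: "real \<Rightarrow> complex"
  assumes J: "is_interval J" "0 \<in> J" and cont: "continuous_on J \<phi>" and inj: "inj_on \<phi> J"
    and \<phi>0: "\<phi> 0 = 0" and "r > 0" and "\<epsilon> > 0"
    and der: "\<And>t. t \<in> J \<Longrightarrow> Re (\<phi> t) = 0 \<Longrightarrow> 0 \<le> Im (\<phi> t) \<Longrightarrow> Im (\<phi> t) < r \<Longrightarrow>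
               \<exists>D>0. ((\<lambda>t. Re (\<phi> t)) has_real_derivative D) (at t)"
    and ret: "\<And>\<eta>. \<eta> > 0 \<Longrightarrow> \<exists>t\<in>J. t \<ge> \<epsilon> \<and> Re (\<phi> t) = 0 \<and> 0 < Im (\<phi> t) \<and> Im (\<phi> t) < \<eta>"
  shows False
proof -
  define \<sigma> where "\<sigma> s = {z. Re z = 0 \<and> 0 \<le> Im z \<and> Im z \<le> s}" for s :: real
  have closed_\<sigma>: "closed (\<sigma> s)" for s
  proof -
    have "\<sigma> s = {z. Re z = 0} \<inter> {z. 0 \<le> Im z} \<inter> {z. Im z \<le> s}" by (auto simp: \<sigma>_def)
    then show ?thesis
      by (simp add: closed_Int closed_Collect_eq closed_Collect_le continuous_on_Re continuous_on_Im)
  qed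
  have sub: "{a..b} \<subseteq> J" if "a \<in> J" "b \<in> J" for a b
    using J(1) that by (meson atLeastAtMost_iff mem_is_interval_1_I subsetI)
  have side: "\<exists>d>0. \<forall>h. 0 < h \<longrightarrow> h < d \<longrightarrow> Re (\<phi> (t + h)) > 0 \<and> Re (\<phi> (t - h)) < 0"
    if t: "t \<in> J" "\<phi> t \<in> \<sigma> s" "s < r" for t s
  proof -
    obtain D where D: "D > 0" "((\<lambda>t. Re (\<phi> t)) has_real_derivative D) (at t)"
      using der[of t] t by (auto simp: \<sigma>_def)
    have "Re (\<phi> t) = 0" using t by (simp add: \<sigma>_def)
    from positive_derivative_at_zero[OF D(2,1) this] show ?thesis .
  qed
  \<comment> \<open>This return only supplies a height below \<open>r\<close>. It guarantees that a
    first return \<open>t\<^sub>1\<close> exists and confines it to the part of the axis where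
    crossings go to the right.\<close>
  obtain t\<^sub>0 where t0: "t\<^sub>0 \<in> J" "t\<^sub>0 \<ge> \<epsilon>" "Re (\<phi> t\<^sub>0) = 0" "0 < Im (\<phi> t\<^sub>0)" "Im (\<phi> t\<^sub>0) < r"
    using ret[OF \<open>r > 0\<close>] by blast
  define s\<^sub>0 where "s\<^sub>0 = Im (\<phi> t\<^sub>0)"
  obtain t\<^sub>1 where t1: "0 < t\<^sub>1" "t\<^sub>1 \<le> t\<^sub>0" "\<phi> t\<^sub>1 \<in> \<sigma> s\<^sub>0"
    and t1_first: "\<And>s. 0 < s \<Longrightarrow> s < t\<^sub>1 \<Longrightarrow> \<phi> s \<notin> \<sigma> s\<^sub>0"
  proof -
    obtain d where d: "d > 0" "\<And>h. 0 < h \<Longrightarrow> h < d \<Longrightarrow> Re (\<phi> (0 + h)) > 0"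
      using side[of 0 0] J \<phi>0 \<open>r > 0\<close> unfolding \<sigma>_def by auto
    have away: "\<phi> (0 + h) \<notin> \<sigma> s\<^sub>0" if "0 < h" "h < d" for h
      using d(2)[OF that] by (simp add: \<sigma>_def)
    have pos: "0 < t\<^sub>0" "\<phi> t\<^sub>0 \<in> \<sigma> s\<^sub>0" using t0 \<open>\<epsilon> > 0\<close> by (auto simp: \<sigma>_def s\<^sub>0_def)
    show thesis
      by (rule first_return_time[OF continuous_on_subset[OF cont sub[OF J(2) t0(1)]] closed_\<sigma> pos d(1) away])
        (assumption+, rule that)
  qed
  have t1J: "t\<^sub>1 \<in> J" using sub[OF J(2) t0(1)] t1 by auto
  define s\<^sub>1 where "s\<^sub>1 = Im (\<phi> t\<^sub>1)"
  have \<phi>t1: "\<phi> t\<^sub>1 = Complex 0 s\<^sub>1" using t1 by (simp add: complex_eq_iff \<sigma>_def s\<^sub>1_def)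
  have "\<phi> t\<^sub>1 \<noteq> 0" using inj_onD[OF inj, of t\<^sub>1 0] t1 t1J J \<phi>0 by auto
  then have s1: "0 < s\<^sub>1" "s\<^sub>1 \<le> s\<^sub>0" "s\<^sub>1 < r"
    using t1 t0 by (auto simp: \<sigma>_def s\<^sub>1_def s\<^sub>0_def complex_eq_iff)
  obtain d\<^sub>1 where d1: "d\<^sub>1 > 0" "\<And>h. 0 < h \<Longrightarrow> h < d\<^sub>1 \<Longrightarrow> Re (\<phi> (t\<^sub>1 + h)) > 0 \<and> Re (\<phi> (t\<^sub>1 - h)) < 0"
    using side[of t\<^sub>1 s\<^sub>1] t1J s1 \<phi>t1 by (auto simp: \<sigma>_def)
  have comp01: "compact (\<phi> ` {a..b})" if "a \<in> J" "b \<in> J" for a b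
    using compact_continuous_image[OF continuous_on_subset[OF cont sub[OF that]]] by blast
  \<comment> \<open>On the times from \<open>e\<close> to \<open>t\<^sub>1\<close> the orbit keeps a
    positive distance \<open>\<eta>\<close> from \<open>0\<close>. A return at height below
    \<open>\<eta>\<close> therefore happens after \<open>t\<^sub>1\<close>.\<close>
  obtain t\<^sub>2 where t2: "t\<^sub>2 \<in> J" "t\<^sub>2 > t\<^sub>1" "\<phi> t\<^sub>2 \<in> \<sigma> s\<^sub>1"
  proof -
    define e where "e = min \<epsilon> t\<^sub>1"
    have e: "e > 0" "e \<le> \<epsilon>" "e \<le> t\<^sub>1" "e \<in> J"
      using \<open>\<epsilon> > 0\<close> t1 sub[OF J(2) t1J] by (auto simp: e_def min_def)
    have "0 \<notin> \<phi> ` {e..t\<^sub>1}"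
      using inj_onD[OF inj, of _ 0] e J \<phi>0 sub[OF e(4) t1J] by fastforce
    then obtain \<eta> where \<eta>: "\<eta> > 0" "\<And>z. z \<in> \<phi> ` {e..t\<^sub>1} \<Longrightarrow> \<eta> \<le> dist 0 z"
      using separate_point_closed[of "\<phi> ` {e..t\<^sub>1}" 0] comp01[OF e(4) t1J] compact_imp_closed by blast
    obtain t where t: "t \<in> J" "t \<ge> \<epsilon>" "Re (\<phi> t) = 0" "0 < Im (\<phi> t)" "Im (\<phi> t) < min \<eta> s\<^sub>1"
      using ret[of "min \<eta> s\<^sub>1"] \<eta> s1 by auto
    have "norm (\<phi> t) = Im (\<phi> t)" using t by (simp add: norm_complex_def)
    then have "\<not> t \<le> t\<^sub>1" using \<eta>(2)[of "\<phi> t"] t e by auto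
    then show thesis using that t by (auto simp: \<sigma>_def)
  qed
  obtain t\<^sub>3 where t3: "t\<^sub>1 < t\<^sub>3" "t\<^sub>3 \<le> t\<^sub>2" "\<phi> t\<^sub>3 \<in> \<sigma> s\<^sub>1"
    and t3_first: "\<And>s. t\<^sub>1 < s \<Longrightarrow> s < t\<^sub>3 \<Longrightarrow> \<phi> s \<notin> \<sigma> s\<^sub>1"
  proof -
    have away: "\<phi> (t\<^sub>1 + h) \<notin> \<sigma> s\<^sub>1" if "0 < h" "h < d\<^sub>1" for h
      using d1(2)[OF that] by (simp add: \<sigma>_def)
    show thesis
      by (rule first_return_time[OF continuous_on_subset[OF cont sub[OF t1J t2(1)]] closed_\<sigma> t2(2,3) d1(1) away])
        (assumption+, rule that)
  qed
  have t3J: "t\<^sub>3 \<in> J" using sub[OF t1J t2(1)] t3 by auto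
  define s\<^sub>3 where "s\<^sub>3 = Im (\<phi> t\<^sub>3)"
  have \<phi>t3: "\<phi> t\<^sub>3 = Complex 0 s\<^sub>3" using t3 by (simp add: complex_eq_iff \<sigma>_def s\<^sub>3_def)
  have "\<phi> t\<^sub>3 \<noteq> 0" "\<phi> t\<^sub>3 \<noteq> \<phi> t\<^sub>1"
    using inj_onD[OF inj, of t\<^sub>3 0] inj_onD[OF inj, of t\<^sub>3 t\<^sub>1] t1 t1J t3 t3J J \<phi>0 by auto
  then have s3: "0 < s\<^sub>3" "s\<^sub>3 < s\<^sub>1"
    using t3(3) unfolding \<phi>t1 \<phi>t3 by (auto simp: \<sigma>_def complex_eq_iff)
  obtain d\<^sub>3 where d3: "d\<^sub>3 > 0" "\<And>h. 0 < h \<Longrightarrow> h < d\<^sub>3 \<Longrightarrow> Re (\<phi> (t\<^sub>3 + h)) > 0 \<and> Re (\<phi> (t\<^sub>3 - h)) < 0"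
    using side[of t\<^sub>3 s\<^sub>3] t3J s3 s1 \<phi>t3 by (auto simp: \<sigma>_def)

  define c where "c = (\<lambda>u. \<phi> (t\<^sub>1 * u)) +++ linepath (Complex 0 s\<^sub>1) 0"
  have im1: "path_image (\<lambda>u. \<phi> (t\<^sub>1 * u)) = \<phi> ` {0..t\<^sub>1}"
  proof -
    have "(\<lambda>u. t\<^sub>1 * u) ` {0..1} = {0..t\<^sub>1}"
      using t1 image_mult_atLeastAtMost[of t\<^sub>1 0 1] by simp
    then show ?thesis unfolding path_image_def by (metis image_image)
  qed
  have im2: "path_image (linepath (Complex 0 s\<^sub>1) 0) = \<sigma> s\<^sub>1"
  proof -
    have "z \<in> closed_segment (Complex 0 s\<^sub>1) 0 \<longleftrightarrow> z \<in> \<sigma> s\<^sub>1" for z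
    proof
      assume "z \<in> \<sigma> s\<^sub>1"
      then have "z = (1 - (1 - Im z / s\<^sub>1)) *\<^sub>R Complex 0 s\<^sub>1 + (1 - Im z / s\<^sub>1) *\<^sub>R 0"
        "0 \<le> 1 - Im z / s\<^sub>1" "1 - Im z / s\<^sub>1 \<le> 1"
        using s1 by (auto simp: \<sigma>_def complex_eq_iff)
      then show "z \<in> closed_segment (Complex 0 s\<^sub>1) 0" unfolding closed_segment_def by blast
    next
      assume "z \<in> closed_segment (Complex 0 s\<^sub>1) 0"
      then show "z \<in> \<sigma> s\<^sub>1"
        using s1 by (auto simp: closed_segment_def \<sigma>_def mult_left_le_one_le)
    qed
    then show ?thesis by auto
  qed
  have sub1: "{0..t\<^sub>1} \<subseteq> J" using sub[OF J(2) t1J] .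
  have arc1: "arc (\<lambda>u. \<phi> (t\<^sub>1 * u))"
    unfolding arc_def path_def
  proof
    have mem: "t\<^sub>1 * u \<in> {0..t\<^sub>1}" if "u \<in> {0..1}" for u
      using that t1 by (auto simp: mult_left_le)
    show "continuous_on {0..1} (\<lambda>u. \<phi> (t\<^sub>1 * u))"
      by (rule continuous_on_compose2[OF continuous_on_subset[OF cont sub1]])
        (use mem in \<open>auto intro!: continuous_intros\<close>)
    show "inj_on (\<lambda>u. \<phi> (t\<^sub>1 * u)) {0..1}"
    proof (rule inj_onI)
      fix u v :: real assume "u \<in> {0..1}" "v \<in> {0..1}" "\<phi> (t\<^sub>1 * u) = \<phi> (t\<^sub>1 * v)"
      then have "t\<^sub>1 * u = t\<^sub>1 * v" using inj_onD[OF inj] mem sub1 by blast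
      then show "u = v" using t1 by simp
    qed
  qed
  have \<sigma>mono: "\<sigma> s\<^sub>1 \<subseteq> \<sigma> s\<^sub>0" using s1 by (auto simp: \<sigma>_def)
  \<comment> \<open>\<open>t\<^sub>1\<close> is the first hit even of the longer piece
    \<open>\<sigma> s\<^sub>0\<close>, so the orbit piece and the segment meet only in their
    endpoints and close up to a simple loop.\<close>
  have orbit\<sigma>: "\<phi> t \<in> \<sigma> s\<^sub>1 \<Longrightarrow> 0 \<le> t \<Longrightarrow> t \<le> t\<^sub>1 \<Longrightarrow> t = 0 \<or> t = t\<^sub>1" for t
    using t1_first[of t] \<sigma>mono by force
  have simple: "simple_path c"
    unfolding c_def
  proof (rule simple_path_join_loop[OF arc1 arc_linepath])
    show "Complex 0 s\<^sub>1 \<noteq> 0" using s1 by (simp add: complex_eq_iff)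
    show "path_image (\<lambda>u. \<phi> (t\<^sub>1 * u)) \<inter> path_image (linepath (Complex 0 s\<^sub>1) 0)
      \<subseteq> {pathstart (\<lambda>u. \<phi> (t\<^sub>1 * u)), pathstart (linepath (Complex 0 s\<^sub>1) 0)}"
      unfolding im1 im2 by (auto dest!: orbit\<sigma> simp: pathstart_def \<phi>t1[symmetric] linepath_def)
  qed (auto simp: pathstart_def pathfinish_def \<phi>0 \<phi>t1 linepath_def)
  have loop: "pathfinish c = pathstart c" by (simp add: c_def pathstart_def pathfinish_def joinpaths_def \<phi>0 linepath_def)
  have imc: "path_image c = \<phi> ` {0..t\<^sub>1} \<union> \<sigma> s\<^sub>1"
    unfolding c_def using im1 im2 by (simp add: path_image_join pathfinish_def pathstart_def \<phi>t1 linepath_def)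
  obtain I E where IE: "open I" "open E" "I \<inter> E = {}" "I \<union> E = - path_image c"
     "frontier I = path_image c" "frontier E = path_image c"
    using Jordan_curve[OF simple loop] by metis

  define M where "M = \<phi> ` {t\<^sub>1<..<t\<^sub>3}"
  have M: "connected M" "M \<inter> path_image c = {}"
  proof -
    have *: "{t\<^sub>1<..<t\<^sub>3} \<subseteq> J" using sub[OF t1J t3J] by auto
    show "connected M" unfolding M_def
      by (intro connected_continuous_image continuous_on_subset[OF cont *]) auto
    show "M \<inter> path_image c = {}"
    proof -
      have "\<phi> t \<noteq> \<phi> s" if "t\<^sub>1 < t" "t < t\<^sub>3" "0 \<le> s" "s \<le> t\<^sub>1" for t s
        using inj_onD[OF inj, of t s] that subsetD[OF *, of t] subsetD[OF sub1, of s] by auto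
      then show ?thesis unfolding M_def imc using t3_first by fastforce
    qed
  qed
  \<comment> \<open>The box to the right of the segment between heights \<open>s\<^sub>3\<close> and
    \<open>s\<^sub>1\<close> is to avoid the old orbit. Shortly before \<open>t\<^sub>1\<close> the
    orbit is on the left; up to the time \<open>e\<close> it is a compact set disjoint from
    \<open>K\<close>. That \<open>K\<close> begins at \<open>s\<^sub>3 > 0\<close> is essential,
    since at \<open>0\<close> the orbit departs to the right.\<close>
  obtain \<rho> where \<rho>: "\<rho> > 0" "\<And>z t. 0 \<le> t \<Longrightarrow> t \<le> t\<^sub>1 \<Longrightarrow> 0 < Re z \<Longrightarrow> Re z < \<rho> \<Longrightarrow> s\<^sub>3 - \<rho> < Im z
      \<Longrightarrow> Im z < s\<^sub>1 + \<rho> \<Longrightarrow> \<phi> t \<noteq> z"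
  proof -
    define e where "e = max 0 (t\<^sub>1 - d\<^sub>1 / 2)"
    have e: "0 \<le> e" "e < t\<^sub>1" "t\<^sub>1 - d\<^sub>1 < e" using t1 d1 by (auto simp: e_def)
    have eJ: "e \<in> J" using e sub1 by auto
    define K where "K = {z. Re z = 0 \<and> s\<^sub>3 \<le> Im z \<and> Im z \<le> s\<^sub>1}"
    have K_eq: "K = {z. Re z = 0} \<inter> {z. s\<^sub>3 \<le> Im z} \<inter> {z. Im z \<le> s\<^sub>1}" by (auto simp: K_def)
    have "closed K" unfolding K_eq
      by (simp add: closed_Int closed_Collect_eq closed_Collect_le continuous_on_Re continuous_on_Im)
    moreover have "\<phi> ` {0..e} \<inter> K = {}"
    proof -
      have "K \<subseteq> \<sigma> s\<^sub>1" "0 \<notin> K" using s3 by (auto simp: K_def \<sigma>_def)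
      then show ?thesis using orbit\<sigma> e \<phi>0 by fastforce
    qed
    ultimately obtain d where d: "d > 0" "\<And>x y. x \<in> \<phi> ` {0..e} \<Longrightarrow> y \<in> K \<Longrightarrow> d \<le> dist x y"
      using separate_compact_closed[OF comp01[OF J(2) eJ]] by metis
    show thesis
    proof (rule that[of "d/2"])
      show "d / 2 > 0" using d by simp
      fix z t assume z: "0 \<le> t" "t \<le> t\<^sub>1" "0 < Re z" "Re z < d/2" "s\<^sub>3 - d/2 < Im z" "Im z < s\<^sub>1 + d/2"
      show "\<phi> t \<noteq> z"
      proof (cases "t \<le> e")
        case True
        \<comment> \<open>The point of \<open>K\<close> nearest to \<open>z\<close>.\<close>
        define y where "y = Complex 0 (max s\<^sub>3 (min s\<^sub>1 (Im z)))"
        have "y \<in> K" using s3 by (auto simp: y_def K_def)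
        have "dist z y \<le> \<bar>Re (z - y)\<bar> + \<bar>Im (z - y)\<bar>" unfolding dist_norm by (rule cmod_le)
        also have "\<dots> < d" using z s3 by (auto simp: y_def min_def max_def)
        finally show ?thesis using d(2)[of "\<phi> t" y] \<open>y \<in> K\<close> True z by force
      next
        case False
        show ?thesis
        proof (cases "t = t\<^sub>1")
          case True
          then show ?thesis using z \<phi>t1 by auto
        next
          case False
          then have "Re (\<phi> t) < 0" using d1(2)[of "t\<^sub>1 - t"] \<open>\<not> t \<le> e\<close> e z by auto
          then show ?thesis using z by auto
        qed
      qed
    qed
  qed
  define R where "R = {z. 0 < Re z \<and> Re z < \<rho> \<and> s\<^sub>3 - \<rho> < Im z \<and> Im z < s\<^sub>1 + \<rho>}"
  have R: "connected R" "R \<inter> path_image c = {}"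
  proof -
    have "R = box (Complex 0 (s\<^sub>3 - \<rho>)) (Complex \<rho> (s\<^sub>1 + \<rho>))"
      by (auto simp: R_def box_def Basis_complex_def)
    then show "connected R" by (simp add: convex_connected)
    show "R \<inter> path_image c = {}" unfolding imc using \<rho> by (fastforce simp: R_def \<sigma>_def)
  qed
  \<comment> \<open>The bounds fit the disc around \<open>\<phi> t\<^sub>3\<close>: its right half
    lies in \<open>R\<close> and its vertical diameter in \<open>\<sigma> s\<^sub>1\<close>, while
    the disc misses the old orbit.\<close>
  obtain \<delta> where \<delta>: "\<delta> > 0" "\<delta> \<le> \<rho>" "\<delta> \<le> s\<^sub>3" "\<delta> \<le> s\<^sub>1 - s\<^sub>3" "ball (\<phi> t\<^sub>3) \<delta> \<inter> \<phi> ` {0..t\<^sub>1} = {}"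
  proof -
    have t3_notin: "\<phi> t\<^sub>3 \<notin> \<phi> ` {0..t\<^sub>1}" using t3 inj_on_image_mem_iff[OF inj t3J sub1] by auto
    obtain d where d: "d > 0" "\<And>z. z \<in> \<phi> ` {0..t\<^sub>1} \<Longrightarrow> d \<le> dist (\<phi> t\<^sub>3) z"
      using separate_point_closed[OF compact_imp_closed[OF comp01[OF J(2) t1J]] t3_notin] by auto
    define \<delta> where "\<delta> = min (min d \<rho>) (min s\<^sub>3 (s\<^sub>1 - s\<^sub>3))"
    have \<delta>: "\<delta> \<le> d" "\<delta> > 0" "\<delta> \<le> \<rho>" "\<delta> \<le> s\<^sub>3" "\<delta> \<le> s\<^sub>1 - s\<^sub>3"
      using d(1) \<rho>(1) s3 by (auto simp: \<delta>_def)
    have "z \<notin> ball (\<phi> t\<^sub>3) \<delta>" if "z \<in> \<phi> ` {0..t\<^sub>1}" for z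
      using d(2)[OF that] \<delta>(1) by simp
    then show thesis using that[OF \<delta>(2-)] by blast
  qed
  define L where "L = ball (\<phi> t\<^sub>3) \<delta> \<inter> {z. Re z < 0}"
  have L: "connected L" "L \<inter> path_image c = {}"
  proof -
    show "connected L" unfolding L_def
      by (intro convex_connected convex_Int convex_ball convex_halfspace_Re_lt)
    show "L \<inter> path_image c = {}" unfolding imc using \<delta> by (auto simp: L_def \<sigma>_def)
  qed
  have near: "\<exists>t. t\<^sub>1 < t \<and> t < t\<^sub>3 \<and> t - t\<^sub>1 < d\<^sub>1 \<and> dist (\<phi> t) (\<phi> t\<^sub>1) < \<rho>"
  proof -
    have "continuous_on {t\<^sub>1..t\<^sub>3} \<phi>" using continuous_on_subset[OF cont sub[OF t1J t3J]] .
    then obtain d where d: "d > 0" "\<And>t. t \<in> {t\<^sub>1..t\<^sub>3} \<Longrightarrow> dist t t\<^sub>1 < d \<Longrightarrow> dist (\<phi> t) (\<phi> t\<^sub>1) < \<rho>"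
      unfolding continuous_on_iff using \<rho>(1) t3 by (metis atLeastAtMost_iff less_eq_real_def)
    define h where "h = Min {d, d\<^sub>1, t\<^sub>3 - t\<^sub>1} / 2"
    have "h > 0" "h < d" "h < d\<^sub>1" "h < t\<^sub>3 - t\<^sub>1"
      using d d1 t3 by (auto simp: h_def min_def)
    then show ?thesis using d(2)[of "t\<^sub>1 + h"] by (intro exI[of _ "t\<^sub>1 + h"]) (auto simp: dist_real_def)
  qed
  have near3: "\<exists>t. t\<^sub>1 < t \<and> t < t\<^sub>3 \<and> t\<^sub>3 - t < d\<^sub>3 \<and> dist (\<phi> t) (\<phi> t\<^sub>3) < \<delta>"
  proof -
    have "continuous_on {t\<^sub>1..t\<^sub>3} \<phi>" using continuous_on_subset[OF cont sub[OF t1J t3J]] .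
    then obtain d where d: "d > 0" "\<And>t. t \<in> {t\<^sub>1..t\<^sub>3} \<Longrightarrow> dist t t\<^sub>3 < d \<Longrightarrow> dist (\<phi> t) (\<phi> t\<^sub>3) < \<delta>"
      unfolding continuous_on_iff using \<delta>(1) t3 by (metis atLeastAtMost_iff less_eq_real_def)
    define h where "h = Min {d, d\<^sub>3, t\<^sub>3 - t\<^sub>1} / 2"
    have "h > 0" "h < d" "h < d\<^sub>3" "h < t\<^sub>3 - t\<^sub>1"
      using d d3 t3 by (auto simp: h_def min_def)
    then show ?thesis using d(2)[of "t\<^sub>3 - h"] by (intro exI[of _ "t\<^sub>3 - h"]) (auto simp: dist_real_def)
  qed
  have RM: "R \<inter> M \<noteq> {}"
  proof -
    obtain t where t: "t\<^sub>1 < t" "t < t\<^sub>3" "t - t\<^sub>1 < d\<^sub>1" "dist (\<phi> t) (\<phi> t\<^sub>1) < \<rho>" using near by blast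
    have "Re (\<phi> t) > 0" using d1(2)[of "t - t\<^sub>1"] t by auto
    moreover have "\<bar>Re (\<phi> t - \<phi> t\<^sub>1)\<bar> < \<rho>" "\<bar>Im (\<phi> t - \<phi> t\<^sub>1)\<bar> < \<rho>"
      using t(4) abs_Re_le_cmod abs_Im_le_cmod unfolding dist_norm by (meson le_less_trans)+
    ultimately have "\<phi> t \<in> R" using s3 by (auto simp: R_def \<phi>t1)
    then show ?thesis using t by (auto simp: M_def)
  qed
  have LM: "L \<inter> M \<noteq> {}"
  proof -
    obtain t where t: "t\<^sub>1 < t" "t < t\<^sub>3" "t\<^sub>3 - t < d\<^sub>3" "dist (\<phi> t) (\<phi> t\<^sub>3) < \<delta>" using near3 by blast
    have "Re (\<phi> t) < 0" using d3(2)[of "t\<^sub>3 - t"] t by auto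
    then have "\<phi> t \<in> L" using t by (simp add: L_def dist_commute)
    then show ?thesis using t by (auto simp: M_def)
  qed
  \<comment> \<open>The new orbit piece \<open>M\<close> leaves \<open>\<phi> t\<^sub>1\<close> into
    \<open>R\<close> and arrives at \<open>\<phi> t\<^sub>3\<close> out of \<open>L\<close>. It thus
    links the two sides of the segment without meeting the loop.\<close>
  define D where "D = R \<union> M \<union> L"
  have D: "connected D" "D \<subseteq> I \<union> E"
    unfolding D_def IE(4) using R M L RM LM
    by (auto intro!: connected_Un)
  have ball_sub: "ball (\<phi> t\<^sub>3) \<delta> \<subseteq> D \<union> path_image c"
  proof
    fix z assume z: "z \<in> ball (\<phi> t\<^sub>3) \<delta>"
    then have "\<bar>Re (z - \<phi> t\<^sub>3)\<bar> < \<delta>" "\<bar>Im (z - \<phi> t\<^sub>3)\<bar> < \<delta>"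
      using abs_Re_le_cmod abs_Im_le_cmod unfolding mem_ball dist_norm norm_minus_commute[of "\<phi> t\<^sub>3"]
      by (meson le_less_trans)+
    then have "\<bar>Re z\<bar> < \<delta>" "\<bar>Im z - s\<^sub>3\<bar> < \<delta>" by (auto simp: \<phi>t3)
    then have "Re z < 0 \<or> z \<in> \<sigma> s\<^sub>1 \<or> z \<in> R"
      using \<delta> s3 by (auto simp: \<sigma>_def R_def)
    then show "z \<in> D \<union> path_image c" using z by (auto simp: D_def L_def imc)
  qed
  \<comment> \<open>Every point of a Jordan curve is a limit of both components. Inside the disc the
    complement of the curve lies in the connected set \<open>D\<close>, so \<open>D\<close> would
    meet both.\<close>
  have "\<phi> t\<^sub>3 \<in> closure I" "\<phi> t\<^sub>3 \<in> closure E"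
    using IE t3 imc unfolding frontier_def by auto
  then have "I \<inter> ball (\<phi> t\<^sub>3) \<delta> \<noteq> {}" "E \<inter> ball (\<phi> t\<^sub>3) \<delta> \<noteq> {}"
    using \<open>\<delta> > 0\<close> by (metis Int_commute centre_in_ball disjoint_iff open_Int_closure_eq_empty open_ball)+
  then have "I \<inter> D \<noteq> {}" "E \<inter> D \<noteq> {}" using ball_sub IE(4) by blast+
  then show False using connectedD[OF D(1) IE(1,2)] D(2) IE(3) by blast
qed

section \<open>Uniqueness of solutions\<close>

text \<open>Lipschitz on bounded sets: the amount of smoothness that uniqueness of solutions uses,
  and stable under time reversal and affine changes of coordinates.\<close>

definition lip_field :: "('a::real_normed_vector \<Rightarrow> 'b::real_normed_vector) \<Rightarrow> bool" where
  "lip_field W \<longleftrightarrow> (\<forall>R. \<exists>L. L-lipschitz_on (cball 0 R) W)"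

lemma lip_field_minus: "lip_field W \<Longrightarrow> lip_field (\<lambda>z. - W z)"
  unfolding lip_field_def lipschitz_on_def by (simp add: dist_minus)

lemma lip_field_continuous: "lip_field W \<Longrightarrow> continuous_on UNIV W"
proof -
  assume "lip_field W"
  have "continuous (at x) W" for x
  proof -
    obtain L where "L-lipschitz_on (cball 0 (norm x + 1)) W" 
      using \<open>lip_field W\<close> unfolding lip_field_def by blast
    then have "continuous_on (ball 0 (norm x + 1)) W"
      using lipschitz_on_continuous_on continuous_on_subset ball_subset_cball by blast
    then show ?thesis by (simp add: continuous_on_eq_continuous_at)
  qed
  then show ?thesis by (simp add: continuous_at_imp_continuous_on)
qed

text \<open>A Gronwall argument, with \<open>L\<close> a Lipschitz constant on a ball containing
  both curves. Derivatives are assumed at interior times only, so the lemma also applies to a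
  solution extended continuously to an endpoint by its limit.\<close>

lemma ode_unique_forward:
  fixes W :: "'a::real_inner \<Rightarrow> 'a"
  assumes W: "lip_field W"
    and cont: "continuous_on {a..b} \<gamma>" "continuous_on {a..b} \<delta>"
    and sol: "\<And>s. a < s \<Longrightarrow> s < b \<Longrightarrow> (\<gamma> has_vector_derivative W (\<gamma> s)) (at s)"
      "\<And>s. a < s \<Longrightarrow> s < b \<Longrightarrow> (\<delta> has_vector_derivative W (\<delta> s)) (at s)"
    and eq: "\<gamma> a = \<delta> a" and s: "s \<in> {a..b}"
  shows "\<gamma> s = \<delta> s"
proof -
  have "bounded (\<gamma> ` {a..b} \<union> \<delta> ` {a..b})"
    using cont by (simp add: compact_continuous_image compact_imp_bounded)
  then obtain R where R: "\<And>t. t \<in> {a..b} \<Longrightarrow> \<gamma> t \<in> cball 0 R \<and> \<delta> t \<in> cball 0 R"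
    unfolding bounded_iff by fastforce
  obtain L where L: "L-lipschitz_on (cball 0 R) W" using W unfolding lip_field_def by blast
  define v where "v t = \<gamma> t - \<delta> t" for t
  \<comment> \<open>The squared distance grows at rate at most \<open>2 * L\<close>; the exponential
    weight cancels this growth, so that \<open>E\<close> decreases from \<open>0\<close>.\<close>
  define E where "E t = exp (- (2 * L * t)) * (v t \<bullet> v t)" for t
  have "E s \<le> E a"
  proof (rule DERIV_nonpos_imp_decreasing_open[of a s E])
    show "a \<le> s" using s by simp
    have "continuous_on {a..b} E"
      unfolding E_def v_def by (intro continuous_intros cont)
    then show "continuous_on {a..s} E" using s by (auto intro: continuous_on_subset)
    fix t assume t: "a < t" "t < s"
    then have tb: "t < b" "t \<in> {a..b}" using s by auto
    define w where "w = W (\<gamma> t) - W (\<delta> t)"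
    have v: "(v has_derivative (\<lambda>h. h *\<^sub>R w)) (at t)"
      using has_vector_derivative_diff[OF sol(1)[OF t(1) tb(1)] sol(2)[OF t(1) tb(1)]]
      unfolding v_def w_def has_vector_derivative_def .
    have "((\<lambda>t. v t \<bullet> v t) has_derivative (\<lambda>h. h * (2 * (v t \<bullet> w)))) (at t)"
      by (rule has_derivative_eq_rhs[OF has_derivative_inner[OF v v]])
        (auto simp: inner_commute algebra_simps)
    then have "((\<lambda>t. v t \<bullet> v t) has_real_derivative 2 * (v t \<bullet> w)) (at t)"
      by (simp add: has_field_derivative_def mult.commute[of "_ * _"] mult_commute_abs)
    then have "(E has_real_derivative exp (- (2 * L * t)) * (2 * (v t \<bullet> w) - 2 * L * (v t \<bullet> v t))) (at t)"
      unfolding E_def by (auto intro!: derivative_eq_intros simp: algebra_simps)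
    moreover have "v t \<bullet> w \<le> L * (v t \<bullet> v t)"
    proof -
      have "v t \<bullet> w \<le> norm (v t) * norm w" by (rule norm_cauchy_schwarz)
      also have "norm (v t) * norm w \<le> norm (v t) * (L * norm (v t))"
      proof (rule mult_left_mono)
        show "norm w \<le> L * norm (v t)"
        using lipschitz_on_normD[OF L] R[OF tb(2)] unfolding w_def v_def by blast
      qed simp
      finally show ?thesis
        by (simp add: dot_square_norm power2_eq_square algebra_simps)
    qed
    then have "exp (- (2 * L * t)) * (2 * (v t \<bullet> w) - 2 * L * (v t \<bullet> v t)) \<le> 0"
      by (simp add: mult_nonneg_nonpos)
    ultimately show "\<exists>y. (E has_real_derivative y) (at t) \<and> y \<le> 0" by blast
  qed
  also have "E a = 0" by (simp add: E_def v_def eq)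
  finally have "v s \<bullet> v s \<le> 0" unfolding E_def by (simp add: mult_le_0_iff)
  then show ?thesis by (metis inner_ge_zero inner_eq_zero_iff order_antisym v_def right_minus_eq)
qed

lemma has_vector_derivative_reverse:
  assumes "(\<gamma> has_vector_derivative w) (at (- s))"
  shows "((\<lambda>s. \<gamma> (- s)) has_vector_derivative - w) (at s)"
proof -
  have "(uminus has_vector_derivative (-1::real)) (at s)"
    by (auto intro!: derivative_eq_intros)
  from vector_diff_chain_at[OF this assms] show ?thesis by (simp add: o_def)
qed

lemma has_vector_derivative_shift_iff:
  "((\<lambda>s. \<gamma> (s + c)) has_vector_derivative w) (at s) \<longleftrightarrow> (\<gamma> has_vector_derivative w) (at (s + c))"
proof -
  have *: "((\<lambda>s. \<gamma> (s + c)) has_vector_derivative w) (at s)"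
    if "(\<gamma> has_vector_derivative w) (at (s + c))" for \<gamma> :: "real \<Rightarrow> 'a" and c s
  proof -
    have "((\<lambda>s. s + c) has_vector_derivative (1::real)) (at s)"
      by (auto intro!: derivative_eq_intros)
    from vector_diff_chain_at[OF this that] show ?thesis by (simp add: o_def)
  qed
  show ?thesis using *[of \<gamma> s c] *[of "\<lambda>s. \<gamma> (s + c)" "s + c" "- c"] by auto
qed

text \<open>Times before \<open>c\<close> are reached by reversing time, which turns
  \<open>W\<close> into its negative.\<close>

lemma ode_unique:
  fixes W :: "'a::real_inner \<Rightarrow> 'a"
  assumes W: "lip_field W"
    and cont: "continuous_on {a..b} \<gamma>" "continuous_on {a..b} \<delta>"
    and sol: "\<And>s. a < s \<Longrightarrow> s < b \<Longrightarrow> (\<gamma> has_vector_derivative W (\<gamma> s)) (at s)"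
      "\<And>s. a < s \<Longrightarrow> s < b \<Longrightarrow> (\<delta> has_vector_derivative W (\<delta> s)) (at s)"
    and eq: "\<gamma> c = \<delta> c" "c \<in> {a..b}" and s: "s \<in> {a..b}"
  shows "\<gamma> s = \<delta> s"
proof (cases "c \<le> s")
  case True
  show ?thesis
    by (rule ode_unique_forward[OF W, of c b])
      (use True assms in \<open>auto intro: continuous_on_subset\<close>)
next
  case False
  have rev: "continuous_on {- c..- a} (\<lambda>s. \<theta> (- s))" if "continuous_on {a..b} \<theta>" for \<theta> :: "real \<Rightarrow> 'a"
    by (rule continuous_on_compose2[OF that]) (use eq in \<open>auto intro!: continuous_intros\<close>)
  have "(\<lambda>s. \<gamma> (- s)) (- s) = (\<lambda>s. \<delta> (- s)) (- s)"
    by (rule ode_unique_forward[OF lip_field_minus[OF W], of "- c" "- a"])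
      (use False eq s in \<open>auto intro!: rev cont has_vector_derivative_reverse sol\<close>)
  then show ?thesis by simp
qed

section \<open>Sign changes and the behaviour of solutions near a regular point\<close>

lemma first_zero:
  fixes u :: "real \<Rightarrow> real"
  assumes cont: "continuous_on {a..b} u" and "a \<le> b" "u a < 0" "u b \<ge> 0"
  obtains s where "s \<in> {a..b}" "u s = 0" "\<And>x. x \<in> {a..<s} \<Longrightarrow> u x < 0"
proof -
  define S where "S = {a..b} \<inter> u -` {0..}"
  have "compact S" unfolding S_def
    using continuous_closed_preimage[OF cont closed_atLeastAtMost closed_atLeast]
    by (metis Int_absorb Int_assoc compact_Icc compact_Int_closed)
  moreover have "b \<in> S" using assms by (auto simp: S_def)
  ultimately obtain s where s: "s \<in> S" "\<And>x. x \<in> S \<Longrightarrow> s \<le> x"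
    using compact_attains_inf[of S] by blast
  have le: "u x < 0" if "x \<in> {a..<s}" for x using s(2)[of x] s(1) that by (force simp: S_def)
  have "u s = 0"
  proof (rule ccontr)
    assume "u s \<noteq> 0"
    then have "u s > 0" using s by (auto simp: S_def)
    then obtain x where "a \<le> x" "x \<le> s" "u x = 0"
      using IVT'[of u a 0 s] \<open>u a < 0\<close> s continuous_on_subset[OF cont, of "{a..s}"]
      by (auto simp: S_def)
    then show False using s(2)[of x] s(1) \<open>u s > 0\<close> by (auto simp: S_def)
  qed
  show thesis
  proof (rule that)
    show "s \<in> {a..b}" using s by (auto simp: S_def)
    show "u s = 0" by fact
    show "u x < 0" if "x \<in> {a..<s}" for x using le[OF that] .
  qed
qed

lemma last_zero:
  fixes u :: "real \<Rightarrow> real"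
  assumes cont: "continuous_on {a..b} u" and "a \<le> b" "u a \<le> 0" "u b > 0"
  obtains s where "s \<in> {a..b}" "u s = 0" "\<And>x. x \<in> {s<..b} \<Longrightarrow> u x > 0"
proof -
  have c: "continuous_on {- b..- a} (\<lambda>x. - u (- x))"
    by (intro continuous_intros continuous_on_compose2[OF cont]) auto
  obtain s where s: "s \<in> {- b..- a}" "- u (- s) = 0" "\<And>x. x \<in> {- b..<s} \<Longrightarrow> - u (- x) < 0"
    by (rule first_zero[OF c]) (use assms in auto)
  show thesis
  proof (rule that[of "- s"])
    show "u x > 0" if "x \<in> {- s<..b}" for x using s(3)[of "- x"] that by auto
  qed (use s in auto)
qed

text \<open>Inside the ball of radius \<open>r\<close> speed is at most \<open>2\<close> and the
  real part grows at rate at least \<open>1/2\<close>, so a displacement is at most \<open>4\<close>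
  times the gain of the real part. As the real part stays nonpositive, this gain is at most
  \<open>norm (\<phi> t)\<close>. Together with the starting norm this gives the factor
  \<open>5\<close>, and \<open>5 * \<kappa> \<le> r\<close> keeps the solution in the ball where the
  bounds hold.\<close>

lemma cone_estimate:
  fixes W :: "complex \<Rightarrow> complex"
  assumes W: "\<And>z. norm z < r \<Longrightarrow> 1/2 \<le> Re (W z) \<and> norm (W z) \<le> 2"
    and "t \<le> v" and sol: "\<And>s. s \<in> {t..v} \<Longrightarrow> (\<phi> has_vector_derivative W (\<phi> s)) (at s)"
    and neg: "\<And>s. s \<in> {t..v} \<Longrightarrow> Re (\<phi> s) \<le> 0"
    and \<kappa>: "norm (\<phi> t) < \<kappa>" "5 * \<kappa> \<le> r"
  shows "norm (\<phi> v) < 5 * \<kappa>" "(v - t) / 2 \<le> Re (\<phi> v) - Re (\<phi> t)"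
proof -
  have cont: "continuous_on {t..v} \<phi>"
    using sol by (meson continuous_at_imp_continuous_on has_vector_derivative_continuous)
  have est: "norm (\<phi> e - \<phi> t) \<le> 2 * (e - t) \<and> (e - t) / 2 \<le> Re (\<phi> e) - Re (\<phi> t)"
    if e: "e \<in> {t..v}" "\<And>s. t < s \<Longrightarrow> s < e \<Longrightarrow> norm (\<phi> s) < r" for e
  proof (cases "t = e")
    case False
    then have "t < e" using e by simp
    have c: "continuous_on {t..e} \<phi>" using e by (auto intro: continuous_on_subset[OF cont])
    have d: "(\<phi> has_derivative (\<lambda>h. h *\<^sub>R W (\<phi> s))) (at s)" if "t < s" "s < e" for s
      using sol[of s] that e by (auto simp: has_vector_derivative_def)
    obtain x where x: "x \<in> {t<..<e}" "norm (\<phi> e - \<phi> t) \<le> norm ((e - t) *\<^sub>R W (\<phi> x))"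
      using mvt_general[OF \<open>t < e\<close> c d] by blast
    have "norm (\<phi> e - \<phi> t) \<le> (e - t) * norm (W (\<phi> x))" using x by simp
    also have "\<dots> \<le> (e - t) * 2"
      by (rule mult_left_mono) (use W[OF e(2)] x in auto)
    finally have 1: "norm (\<phi> e - \<phi> t) \<le> 2 * (e - t)" by simp
    have "((\<lambda>s. Re (\<phi> s)) has_derivative (\<lambda>h. h * Re (W (\<phi> s)))) (at s)" if "t < s" "s < e" for s
      using has_derivative_Re[OF d[OF that]] by simp
    then obtain y where y: "y \<in> {t<..<e}" "Re (\<phi> e) - Re (\<phi> t) = (e - t) * Re (W (\<phi> y))"
      using mvt[OF \<open>t < e\<close> continuous_on_Re[OF c], of "\<lambda>s h. h * Re (W (\<phi> s))"] by auto
    have "(e - t) * (1/2) \<le> (e - t) * Re (W (\<phi> y))"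
      by (rule mult_left_mono) (use W[OF e(2)] y in auto)
    then show ?thesis using 1 y by simp
  qed simp
  have small: "norm (\<phi> e) < 5 * \<kappa>" if "e \<in> {t..v}" for e
  proof (rule ccontr)
    assume "\<not> norm (\<phi> e) < 5 * \<kappa>"
    \<comment> \<open>The first time on the sphere of radius \<open>5 * \<kappa>\<close>: until then
      the bounds on \<open>W\<close> are available, and they exclude reaching the sphere.\<close>
    define u where "u s = norm (\<phi> s) - 5 * \<kappa>" for s
    have cu: "continuous_on {t..e} u" unfolding u_def
      using that by (intro continuous_on_diff continuous_on_norm continuous_on_const continuous_on_subset[OF cont]) auto
    have "0 \<le> norm (\<phi> t)" by simp
    then have ut: "u t < 0" unfolding u_def using \<kappa>(1) by linarith
    have ue: "t \<le> e" "u e \<ge> 0" using \<open>\<not> norm (\<phi> e) < 5 * \<kappa>\<close> that by (simp_all add: u_def)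
    obtain x where x: "x \<in> {t..e}" "u x = 0" and less: "\<And>y. y \<in> {t..<x} \<Longrightarrow> u y < 0"
      using first_zero[of t e u, OF cu ue(1) ut ue(2)] by blast
    have "norm (\<phi> y) < r" if "t < y" "y < x" for y
      using less[of y] that \<kappa> by (simp add: u_def)
    then have *: "norm (\<phi> x - \<phi> t) \<le> 4 * (Re (\<phi> x) - Re (\<phi> t))"
      using est[of x] x that by auto
    have "Re (\<phi> x) \<le> 0" using neg[of x] x that by auto
    moreover have "- Re (\<phi> t) \<le> norm (\<phi> t)" using abs_Re_le_cmod[of "\<phi> t"] by linarith
    ultimately have "norm (\<phi> x) \<le> 5 * norm (\<phi> t)"
      using * norm_triangle_ineq2[of "\<phi> x" "\<phi> t"] by (smt (verit))
    then have "norm (\<phi> x) < 5 * \<kappa>" using \<kappa>(1) by linarith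
    then show False using x by (auto simp: u_def)
  qed
  show "norm (\<phi> v) < 5 * \<kappa>" using small \<open>t \<le> v\<close> by simp
  show "(v - t) / 2 \<le> Re (\<phi> v) - Re (\<phi> t)" 
  proof -
    have "norm (\<phi> s) < r" if "t < s" "s < v" for s using small[of s] that \<kappa>(2) by simp
    then show ?thesis using est[of v] \<open>t \<le> v\<close> by simp
  qed
qed

section \<open>Injective planar orbits are embedded\<close>

text \<open>An orbit that comes back close to \<open>0\<close> crosses the imaginary axis there, unless it converges to
  \<open>0\<close>. In the latter case it does so in finite time, and by uniqueness it would be periodic.\<close>

lemma nonrecurrent_normal_form:
  fixes W :: "complex \<Rightarrow> complex"
  assumes W: "lip_field W" "W 0 = 1"
    and J: "open J" "is_interval J" "0 \<in> J" and inj: "inj_on \<phi> J" and \<phi>0: "\<phi> 0 = 0"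
    and sol: "\<And>t. t \<in> J \<Longrightarrow> (\<phi> has_vector_derivative W (\<phi> t)) (at t)" and "\<epsilon> > 0"
  shows "\<exists>\<eta>>0. \<forall>t\<in>J. \<epsilon> \<le> t \<longrightarrow> \<eta> \<le> norm (\<phi> t)"
proof (rule ccontr)
  assume "\<not> ?thesis"
  then have rec: "\<exists>t\<in>J. \<epsilon> \<le> t \<and> norm (\<phi> t) < \<eta>" if "\<eta> > 0" for \<eta>
    using that by (meson not_le)
  have sub: "{a..b} \<subseteq> J" if "a \<in> J" "b \<in> J" for a b
    using J(2) that by (meson atLeastAtMost_iff mem_is_interval_1_I subsetI)
  have cont: "continuous_on J \<phi>"
    using sol by (meson continuous_at_imp_continuous_on has_vector_derivative_continuous)
  have cRe: "continuous_on {a..b} (\<lambda>t. Re (\<phi> t))" if "a \<in> J" "b \<in> J" for a b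
    by (rule continuous_on_Re[OF continuous_on_subset[OF cont sub[OF that]]])
  have derRe: "((\<lambda>t. Re (\<phi> t)) has_real_derivative Re (W (\<phi> t))) (at t)" if "t \<in> J" for t
    using has_derivative_Re[OF sol[OF that, unfolded has_vector_derivative_def]]
    by (simp add: has_field_derivative_def mult_commute_abs)
  obtain r where "r > 0" and r: "\<And>z. norm z < r \<Longrightarrow> 1/2 \<le> Re (W z) \<and> norm (W z) \<le> 2"
  proof -
    have "isCont W 0" using lip_field_continuous[OF W(1)] by (simp add: continuous_on_eq_continuous_at)
    then obtain r where r: "r > 0" "\<And>z. norm z < r \<Longrightarrow> norm (W z - 1) < 1/2"
      unfolding continuous_at_eps_delta using W(2)
      by (metis dist_0_norm dist_commute dist_norm half_gt_zero_iff zero_less_one)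
    have "1/2 \<le> Re (W z) \<and> norm (W z) \<le> 2" if "norm z < r" for z
      using r(2)[OF that] abs_Re_le_cmod[of "W z - 1"] norm_triangle_ineq2[of "W z" 1] by (simp; linarith)
    then show thesis using that r(1) by blast
  qed
  have \<epsilon>J: "\<epsilon> \<in> J" using rec[of 1] sub[OF J(3)] \<open>\<epsilon> > 0\<close> by fastforce
  \<comment> \<open>The orbit starts to the right. The value \<open>Re (\<phi> e)\<close> serves as
    a barrier: an orbit point followed backward to \<open>e\<close> with nonnegative real part must
    have real part at least this large.\<close>
  obtain e where e: "0 < e" "e \<le> \<epsilon>" "e \<in> J" "Re (\<phi> e) > 0"
  proof -
    have pos: "Re (W (\<phi> 0)) > 0" "Re (\<phi> 0) = 0" using \<phi>0 W(2) by auto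
    obtain d where d: "d > 0" "\<And>h. 0 < h \<Longrightarrow> h < d \<Longrightarrow> Re (\<phi> (0 + h)) > 0"
      using positive_derivative_at_zero[OF derRe[OF J(3)] pos] by blast
    show thesis
      by (rule that[of "min \<epsilon> (d/2)"])
        (use d(1) d(2)[of "min \<epsilon> (d/2)"] \<open>\<epsilon> > 0\<close> sub[OF J(3) \<epsilon>J] in auto)
  qed
  have crossing: "\<exists>t\<in>J. t \<ge> e \<and> Re (\<phi> t) = 0 \<and> norm (\<phi> t) < \<eta>" if "\<eta> > 0" for \<eta>
  proof (rule ccontr)
    assume none: "\<not> ?thesis"
    \<comment> \<open>Without crossings, an orbit point within \<open>\<kappa>\<close> of
      \<open>0\<close> must lie to the left, and its future stays there. The real part then has less
      than \<open>\<kappa>\<close> to gain at rate at least \<open>1/2\<close>, so the remaining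
      lifetime is at most \<open>2 * \<kappa>\<close>.\<close>
    have tail: "\<exists>t\<in>J. \<epsilon> \<le> t \<and> (\<forall>v\<in>J. t \<le> v \<longrightarrow> norm (\<phi> v) < 5 * \<kappa> \<and> v \<le> t + 2 * \<kappa>)"
      if \<kappa>: "\<kappa> > 0" "\<kappa> \<le> Re (\<phi> e)" "5 * \<kappa> \<le> r" "5 * \<kappa> \<le> \<eta>" for \<kappa>
    proof -
      obtain t where t: "t \<in> J" "\<epsilon> \<le> t" "norm (\<phi> t) < \<kappa>" using rec[OF \<kappa>(1)] by blast
      have "e \<le> t" using e t by simp
      have Re_small: "\<bar>Re (\<phi> t)\<bar> < \<kappa>" using abs_Re_le_cmod[of "\<phi> t"] t by linarith
      \<comment> \<open>Follow the orbit backward from \<open>t\<close>. Either it meets the axis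
        within \<open>5 * \<kappa>\<close> of \<open>0\<close>, which is a crossing, or it stays on
        the right down to \<open>e\<close>, which contradicts
        \<open>\<kappa> \<le> Re (\<phi> e)\<close>.\<close>
      have "\<not> Re (\<phi> t) > 0"
      proof
        assume pos: "Re (\<phi> t) > 0"
        have bwd: "norm (\<phi> s) < 5 * \<kappa> \<and> Re (\<phi> s) \<le> Re (\<phi> t)"
          if s: "s \<in> {e..t}" "\<And>x. x \<in> {s..t} \<Longrightarrow> Re (\<phi> x) \<ge> 0" for s
        proof -
          have mem: "- x \<in> J" if "x \<in> {- t..- s}" for x
            using sub[OF e(3) t(1)] s that by auto
          \<comment> \<open>Reversing time and reflecting in \<open>0\<close> moves the right half
            plane to the left one and yields a solution of \<open>W (- z)\<close>, to which the
            forward cone estimate applies with the same constants.\<close>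
          define \<psi> where "\<psi> x = - \<phi> (- x)" for x
          have "(\<psi> has_vector_derivative W (- \<psi> x)) (at x)" if "x \<in> {- t..- s}" for x
            using has_vector_derivative_minus[OF has_vector_derivative_reverse[OF sol[OF mem[OF that]]]]
            by (simp add: \<psi>_def[abs_def])
          from cone_estimate[of r "\<lambda>z. W (- z)" "- t" "- s" \<psi> \<kappa>, OF _ _ this]
          show ?thesis using s t \<kappa> r by (auto simp: \<psi>_def)
        qed
        show False
        proof (cases "Re (\<phi> e) \<le> 0")
          case True
          then show False using e by simp
        next
          case False
          show False
          proof (cases "\<forall>s\<in>{e..t}. Re (\<phi> s) \<ge> 0")
            case True
            then have "Re (\<phi> e) \<le> Re (\<phi> t)" using bwd[of e] \<open>e \<le> t\<close> by auto
            then show False using \<kappa> Re_small by linarith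
          next
            case False
            then obtain x where x: "x \<in> {e..t}" "Re (\<phi> x) \<le> 0" by fastforce
            have xJ: "x \<in> J" using x sub[OF e(3) t(1)] by auto
            obtain s where s: "s \<in> {x..t}" "Re (\<phi> s) = 0" "\<And>y. y \<in> {s<..t} \<Longrightarrow> Re (\<phi> y) > 0"
              using last_zero[of x t "\<lambda>t. Re (\<phi> t)", OF cRe[OF xJ t(1)]] x pos by auto
            have "norm (\<phi> s) < 5 * \<kappa>" using bwd[of s] s x by (force simp: le_less)
            moreover have "s \<in> J" "s \<ge> e" using s x sub[OF xJ t(1)] by auto
            ultimately show False using none s(2) \<kappa> by auto
          qed
        qed
      qed
      moreover have "Re (\<phi> t) \<noteq> 0" using none t \<open>e \<le> t\<close> \<kappa> by force
      ultimately have neg: "Re (\<phi> t) < 0" by linarith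
      have fwd: "norm (\<phi> s) < 5 * \<kappa> \<and> (s - t) / 2 \<le> Re (\<phi> s) - Re (\<phi> t)"
        if s: "s \<in> J" "t \<le> s" "\<And>x. x \<in> {t..s} \<Longrightarrow> Re (\<phi> x) \<le> 0" for s
        using cone_estimate[of r W t s \<phi> \<kappa>, OF r s(2) sol s(3) t(3) \<kappa>(3)] sub[OF t(1) s(1)] by blast
      have allneg: "Re (\<phi> v) < 0" if v: "v \<in> J" "t \<le> v" for v
      proof (rule ccontr)
        assume "\<not> Re (\<phi> v) < 0"
        then obtain s where s: "s \<in> {t..v}" "Re (\<phi> s) = 0" "\<And>y. y \<in> {t..<s} \<Longrightarrow> Re (\<phi> y) < 0"
          using first_zero[of t v "\<lambda>t. Re (\<phi> t)", OF cRe[OF t(1) v(1)]] v neg by auto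
        have "s \<in> J" using s sub[OF t(1) v(1)] by auto
        moreover have "norm (\<phi> s) < 5 * \<kappa>" using fwd[OF \<open>s \<in> J\<close>] s by (force simp: le_less)
        ultimately show False using none s \<open>e \<le> t\<close> \<kappa> by auto
      qed
      have "norm (\<phi> v) < 5 * \<kappa> \<and> v \<le> t + 2 * \<kappa>" if v: "v \<in> J" "t \<le> v" for v
      proof -
        have "norm (\<phi> v) < 5 * \<kappa> \<and> (v - t) / 2 \<le> Re (\<phi> v) - Re (\<phi> t)"
          using fwd[OF v] allneg sub[OF t(1) v(1)] by (meson atLeastAtMost_iff less_imp_le subsetD)
        then show ?thesis using allneg[OF v] Re_small by (auto simp: field_simps)
      qed
      then show ?thesis using t by blast
    qed
    define \<kappa>\<^sub>0 where "\<kappa>\<^sub>0 = min (Re (\<phi> e)) (min (r/5) (\<eta>/5))"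
    have \<kappa>0: "\<kappa>\<^sub>0 > 0" "\<kappa>\<^sub>0 \<le> Re (\<phi> e)" "5 * \<kappa>\<^sub>0 \<le> r" "5 * \<kappa>\<^sub>0 \<le> \<eta>"
      using e \<open>r > 0\<close> that by (auto simp: \<kappa>\<^sub>0_def)
    have tail': "\<exists>t\<in>J. \<epsilon> \<le> t \<and> (\<forall>v\<in>J. t \<le> v \<longrightarrow> norm (\<phi> v) < x \<and> v \<le> t + 2 * \<kappa>\<^sub>0)" if "x > 0" for x
    proof -
      have "min \<kappa>\<^sub>0 (x/5) > 0" "min \<kappa>\<^sub>0 (x/5) \<le> Re (\<phi> e)" "5 * min \<kappa>\<^sub>0 (x/5) \<le> r"
        "5 * min \<kappa>\<^sub>0 (x/5) \<le> \<eta>" using \<kappa>0 that by (auto simp: min_def)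
      from tail[OF this] obtain t where "t \<in> J" "\<epsilon> \<le> t"
        "\<forall>v\<in>J. t \<le> v \<longrightarrow> norm (\<phi> v) < 5 * min \<kappa>\<^sub>0 (x/5) \<and> v \<le> t + 2 * min \<kappa>\<^sub>0 (x/5)" by blast
      moreover have "5 * min \<kappa>\<^sub>0 (x/5) \<le> x" "2 * min \<kappa>\<^sub>0 (x/5) \<le> 2 * \<kappa>\<^sub>0" by auto
      ultimately show ?thesis by (intro bexI[of _ t]) force+
    qed
    \<comment> \<open>The orbit ends at a finite time \<open>T\<close> and tends to
      \<open>0 = \<phi> 0\<close> there.\<close>
    have bdd: "bdd_above J"
    proof -
      obtain t where t: "\<And>v. v \<in> J \<Longrightarrow> t \<le> v \<Longrightarrow> v \<le> t + 2 * \<kappa>\<^sub>0" using tail'[of 1] by auto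
      then have "v \<le> t + 2 * \<kappa>\<^sub>0" if "v \<in> J" for v using that \<kappa>0 by (cases "t \<le> v") auto
      then show ?thesis by (rule bdd_aboveI)
    qed
    define T where "T = Sup J"
    have le_T: "v \<le> T" if "v \<in> J" for v using cSup_upper[OF that bdd] by (simp add: T_def)
    have "T \<notin> J"
    proof
      assume "T \<in> J"
      then obtain d where "d > 0" "ball T d \<subseteq> J" using J(1) openE by blast
      then have "T + d/2 \<in> J" by (auto simp: dist_real_def subset_iff)
      then show False using le_T[of "T + d/2"] \<open>d > 0\<close> by simp
    qed
    have below_T: "v \<in> J" if v: "0 \<le> v" "v < T" for v
    proof -
      obtain w where "w \<in> J" "v < w" using less_cSupD[of J v] J v by (auto simp: T_def)
      then show ?thesis using sub[OF J(3), of w] v by auto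
    qed
    have "T > 0" using le_T[OF \<epsilon>J] \<open>\<epsilon> > 0\<close> by simp
    obtain d where d: "d > 0" "d \<le> T" "- d \<in> J"
    proof -
      obtain x where "x > 0" "ball 0 x \<subseteq> J" using J openE by blast
      then have "- min (x/2) T \<in> J" using \<open>T > 0\<close> by (auto simp: dist_real_def subset_iff)
      then show thesis using that[of "min (x/2) T"] \<open>x > 0\<close> \<open>T > 0\<close> by auto
    qed
    \<comment> \<open>The orbit completed by its limit at \<open>T\<close> is compared with the
      orbit shifted by \<open>T\<close>. Both are at \<open>0\<close> at time \<open>T\<close>, so
      uniqueness backward from \<open>T\<close> makes the orbit take the same point at the times
      \<open>T - d\<close> and \<open>- d\<close>.\<close>
    define \<psi> where "\<psi> t = (if t < T then \<phi> t else 0)" for t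
    have "\<psi> (T - d) = (\<lambda>s. \<phi> (s + (- T))) (T - d)"
    proof (rule ode_unique[OF W(1), where a = "T - d" and b = T and c = T and \<gamma> = \<psi> and \<delta> = "\<lambda>s. \<phi> (s + (- T))"])
      show "continuous_on {T - d..T} (\<lambda>s. \<phi> (s + (- T)))"
        by (rule continuous_on_compose2[OF continuous_on_subset[OF cont sub[OF d(3) J(3)]]])
          (auto intro!: continuous_intros)
      show "continuous_on {T - d..T} \<psi>"
        unfolding continuous_on_iff
      proof (intro ballI allI impI)
        fix s x :: real assume s: "s \<in> {T - d..T}" "0 < x"
        show "\<exists>c>0. \<forall>s'\<in>{T - d..T}. dist s' s < c \<longrightarrow> dist (\<psi> s') (\<psi> s) < x"
        proof (cases "s < T")
          case True
          then have "s \<in> J" using below_T[of s] s d by auto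
          then have "isCont \<phi> s" using sol has_vector_derivative_continuous by blast
          then obtain c where c: "c > 0" "\<And>s'. dist s' s < c \<Longrightarrow> dist (\<phi> s') (\<phi> s) < x"
            using s(2) unfolding continuous_at_eps_delta by blast
          show ?thesis
            by (rule exI[of _ "min c (T - s)"]) (use c True in \<open>auto simp: \<psi>_def dist_real_def\<close>)
        next
          case False
          then have "s = T" using s by simp
          obtain t where t: "t \<in> J" "\<And>v. v \<in> J \<Longrightarrow> t \<le> v \<Longrightarrow> norm (\<phi> v) < x" using tail'[OF s(2)] by blast
          have "t < T" using le_T[OF t(1)] \<open>T \<notin> J\<close> t(1) by (metis less_eq_real_def)
          have "dist (\<psi> s') (\<psi> s) < x" if "s' \<in> {T - d..T}" "dist s' s < T - t" for s'
          proof (cases "s' < T")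
            case True
            then have "norm (\<phi> s') < x"
              using that t(2)[of s'] below_T[of s'] d \<open>s = T\<close> by (auto simp: dist_real_def)
            then show ?thesis using True \<open>s = T\<close> by (simp add: \<psi>_def)
          qed (use s \<open>s = T\<close> in \<open>simp add: \<psi>_def\<close>)
          then show ?thesis using \<open>t < T\<close> by (intro exI[of _ "T - t"]) auto
        qed
      qed
      show "((\<lambda>s. \<phi> (s + (- T))) has_vector_derivative W (\<phi> (s + (- T)))) (at s)" if "T - d < s" "s < T" for s
        unfolding has_vector_derivative_shift_iff
        by (rule sol) (use sub[OF d(3) J(3)] that in auto)
      show "(\<psi> has_vector_derivative W (\<psi> s)) (at s)" if s: "T - d < s" "s < T" for s
      proof -
        have "(\<phi> has_vector_derivative W (\<psi> s)) (at s)"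
          using sol[OF below_T[of s]] s d by (auto simp: \<psi>_def)
        then show ?thesis
          by (rule has_vector_derivative_transform_within_open[of _ _ _ "{..<T}"]) (use s in \<open>auto simp: \<psi>_def\<close>)
      qed
    qed (use d \<phi>0 in \<open>auto simp: \<psi>_def\<close>)
    then have "\<phi> (T - d) = \<phi> (- d)" using d by (simp add: \<psi>_def)
    then have "T - d = - d" using inj_onD[OF inj] below_T[of "T - d"] d by auto
    then show False using \<open>T > 0\<close> by simp
  qed
  have ImRe: "Im (\<phi> t) \<noteq> 0" if "t \<in> J" "t \<ge> e" "Re (\<phi> t) = 0" for t
    using inj_onD[OF inj, of t 0] that e J \<phi>0 by (auto simp: complex_eq_iff)
  have Im_norm: "\<bar>Im z\<bar> = norm z" if "Re z = 0" for z using that by (simp add: norm_complex_def)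
  have D: "\<exists>D>0. ((\<lambda>t. Re (\<phi> t)) has_real_derivative D) (at t)"
    if "t \<in> J" "Re (\<phi> t) = 0" "\<bar>Im (\<phi> t)\<bar> < r" for t
  proof -
    have "1/2 \<le> Re (W (\<phi> t))" using r[of "\<phi> t"] Im_norm[of "\<phi> t"] that by simp
    then show ?thesis using derRe[OF that(1)] by (intro exI[of _ "Re (W (\<phi> t))"]) simp
  qed
  show False
  \<comment> \<open>Crossings accumulate at \<open>0\<close> from above or from below. Conjugation
    exchanges the two cases and keeps real parts, hence also the direction of crossing.\<close>
  proof (cases "\<forall>\<eta>>0. \<exists>t\<in>J. t \<ge> e \<and> Re (\<phi> t) = 0 \<and> 0 < Im (\<phi> t) \<and> Im (\<phi> t) < \<eta>")
    case True
    show False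
      by (rule no_returns_to_half_transversal[OF J(2,3) cont inj \<phi>0 \<open>r > 0\<close> e(1)])
        (use True D in auto)
  next
    case False
    then obtain \<eta>\<^sub>0 where \<eta>0: "\<eta>\<^sub>0 > 0"
      "\<And>t. t \<in> J \<Longrightarrow> t \<ge> e \<Longrightarrow> Re (\<phi> t) = 0 \<Longrightarrow> 0 < Im (\<phi> t) \<Longrightarrow> \<not> Im (\<phi> t) < \<eta>\<^sub>0" by blast
    have "\<exists>t\<in>J. t \<ge> e \<and> Re (cnj (\<phi> t)) = 0 \<and> 0 < Im (cnj (\<phi> t)) \<and> Im (cnj (\<phi> t)) < \<eta>"
      if \<eta>: "\<eta> > 0" for \<eta>
    proof -
      obtain t where t: "t \<in> J" "t \<ge> e" "Re (\<phi> t) = 0" "norm (\<phi> t) < min \<eta> \<eta>\<^sub>0"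
        using crossing[of "min \<eta> \<eta>\<^sub>0"] \<eta>0(1) \<eta> by auto
      then have "\<bar>Im (\<phi> t)\<bar> < min \<eta> \<eta>\<^sub>0" using Im_norm by metis
      then have "Im (\<phi> t) < 0" using \<eta>0(2)[OF t(1-3)] ImRe[OF t(1-3)] by (smt (verit) min_less_iff_conj)
      then show ?thesis using t \<open>\<bar>Im (\<phi> t)\<bar> < min \<eta> \<eta>\<^sub>0\<close> by (intro bexI[of _ t]) auto
    qed
    then show False
      by (intro no_returns_to_half_transversal[of J "\<lambda>t. cnj (\<phi> t)" r e])
        (use J \<phi>0 \<open>r > 0\<close> e D inj in \<open>auto simp: inj_on_def intro!: continuous_on_cnj cont\<close>)
  qed
qed

section \<open>From smooth planar fields to the normal form\<close>

lemma smooth2_lip: "smooth2 g \<Longrightarrow> lip_field g"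
proof -
  have cont: "continuous_on UNIV g" if "smooth2 g" for g
    using that
    by (cases rule: smooth2.cases) (meson continuous_at_imp_continuous_on has_derivative_continuous)
  assume "smooth2 g"
  \<comment> \<open>One unfolding of the coinductive definition suffices: the partial derivatives
    are smooth again, hence continuous and bounded on a compact ball.\<close>
  then obtain gx gy where der: "\<And>z. (g has_derivative (\<lambda>v. fst v * gx z + snd v * gy z)) (at z)"
    and "smooth2 gx" "smooth2 gy"
    by (cases rule: smooth2.cases) blast
  show ?thesis unfolding lip_field_def
  proof
    fix R :: real
    have "compact (gx ` cball 0 R)" "compact (gy ` cball 0 R)"
      using cont[OF \<open>smooth2 gx\<close>] cont[OF \<open>smooth2 gy\<close>]
      by (auto intro!: compact_continuous_image intro: continuous_on_subset)
    then obtain A B where AB: "A > 0" "\<And>z. z \<in> cball 0 R \<Longrightarrow> \<bar>gx z\<bar> \<le> A"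
        "B > 0" "\<And>z. z \<in> cball 0 R \<Longrightarrow> \<bar>gy z\<bar> \<le> B"
      by (metis compact_imp_bounded bounded_pos image_eqI real_norm_def)
    have "(A + B)-lipschitz_on (cball 0 R) g"
    proof (rule bounded_derivative_imp_lipschitz)
      fix z :: pt assume z: "z \<in> cball 0 R"
      show "(g has_derivative (\<lambda>v. fst v * gx z + snd v * gy z)) (at z within cball 0 R)"
        using der has_derivative_at_withinI by blast
      show "onorm (\<lambda>v. fst v * gx z + snd v * gy z) \<le> A + B"
      proof (rule onorm_bound)
        fix v :: pt
        have "\<bar>fst v * gx z + snd v * gy z\<bar> \<le> \<bar>fst v\<bar> * \<bar>gx z\<bar> + \<bar>snd v\<bar> * \<bar>gy z\<bar>"
          by (metis abs_mult abs_triangle_ineq)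
        also have "\<dots> \<le> norm v * A + norm v * B"
          using AB z norm_fst_le[of "fst v" "snd v"] norm_snd_le[of "snd v" "fst v"] by (intro add_mono mult_mono) auto
        finally show "norm (fst v * gx z + snd v * gy z) \<le> (A + B) * norm v"
          by (simp add: algebra_simps)
      qed (use AB in simp)
    qed (use AB in auto)
    then show "\<exists>L. L-lipschitz_on (cball 0 R) g" by blast
  qed
qed

lemma smooth_field_lip: "smooth_field X \<Longrightarrow> lip_field X"
proof -
  assume "smooth_field X"
  then have *: "lip_field (\<lambda>z. fst (X z))" "lip_field (\<lambda>z. snd (X z))"
    by (simp_all add: smooth_field_def smooth2_lip)
  show ?thesis unfolding lip_field_def
  proof
    fix R :: real
    obtain L M where "L-lipschitz_on (cball 0 R) (\<lambda>z. fst (X z))" "M-lipschitz_on (cball 0 R) (\<lambda>z. snd (X z))"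
      using * unfolding lip_field_def by blast
    from lipschitz_on_Pair[OF this] show "\<exists>L. L-lipschitz_on (cball 0 R) X" by auto
  qed
qed

lemma lip_field_affine:
  fixes W :: "'a::real_normed_vector \<Rightarrow> 'c::real_normed_vector"
    and A :: "'b::real_normed_vector \<Rightarrow> 'a" and B :: "'c \<Rightarrow> 'd::real_normed_vector"
  assumes "lip_field W" "bounded_linear A" "bounded_linear B"
  shows "lip_field (\<lambda>z. B (W (q + A z)))"
  unfolding lip_field_def
proof
  fix R :: real
  obtain C where C: "C > 0" "\<And>z. norm (A z) \<le> norm z * C" using bounded_linear.pos_bounded[OF assms(2)] by blast
  obtain D where D: "D > 0" "\<And>z. norm (B z) \<le> norm z * D" using bounded_linear.pos_bounded[OF assms(3)] by blast
  obtain L where L: "L-lipschitz_on (cball 0 (norm q + R * C)) W"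
    using assms(1) unfolding lip_field_def by blast
  have "(L * C * D)-lipschitz_on (cball 0 R) (\<lambda>z. B (W (q + A z)))"
  proof (rule lipschitz_onI)
    fix x y :: 'b assume xy: "x \<in> cball 0 R" "y \<in> cball 0 R"
    have mem: "q + A z \<in> cball 0 (norm q + R * C)" if "z \<in> cball 0 R" for z
    proof -
      have "norm (A z) \<le> R * C"
        using C(2)[of z] that C(1) by (meson mem_cball_0 mult_right_mono order_trans less_imp_le)
      then show ?thesis using norm_triangle_ineq[of q "A z"] by simp
    qed
    have "norm (B (W (q + A x)) - B (W (q + A y))) = norm (B (W (q + A x) - W (q + A y)))"
      by (simp add: bounded_linear.axioms(1)[OF assms(3)] linear_diff bounded_linear.linear[OF assms(3)])
    also have "\<dots> \<le> norm (W (q + A x) - W (q + A y)) * D" by (rule D)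
    also have "\<dots> \<le> (L * norm (A x - A y)) * D"
      using lipschitz_on_normD[OF L mem[OF xy(1)] mem[OF xy(2)]] D(1) by (intro mult_right_mono) auto
    also have "norm (A x - A y) \<le> norm (x - y) * C"
      using C(2)[of "x - y"] by (simp add: linear_diff bounded_linear.linear[OF assms(2)])
    finally show "dist (B (W (q + A x))) (B (W (q + A y))) \<le> L * C * D * dist x y"
      using lipschitz_on_nonneg[OF L] D(1)
      by (simp add: dist_norm mult_left_mono mult_right_mono mult_ac)
  next
    show "0 \<le> L * C * D" using lipschitz_on_nonneg[OF L] C D by simp
  qed
  then show "\<exists>L. L-lipschitz_on (cball 0 R) (\<lambda>z. B (W (q + A z)))" by blast
qed

text \<open>At an equilibrium uniqueness would make the orbit constant for a while, against
  injectivity.\<close>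

lemma orbit_field_nonzero:
  fixes W :: "'a::real_inner \<Rightarrow> 'a"
  assumes W: "lip_field W" and J: "open J" "is_interval J" "t \<in> J" and inj: "inj_on \<phi> J"
    and sol: "\<And>t. t \<in> J \<Longrightarrow> (\<phi> has_vector_derivative W (\<phi> t)) (at t)"
  shows "W (\<phi> t) \<noteq> 0"
proof
  assume 0: "W (\<phi> t) = 0"
  obtain d where "d > 0" "cball t d \<subseteq> J" using J open_contains_cball by blast
  then have sub: "s \<in> J" if "t \<le> s" "s \<le> t + d" for s using that by (force simp: dist_real_def)
  have "continuous_on {t..t + d} \<phi>"
    by (intro continuous_at_imp_continuous_on ballI has_vector_derivative_continuous[OF sol] sub) auto
  then
  have "\<phi> (t + d) = (\<lambda>_. \<phi> t) (t + d)"
    by (rule ode_unique[OF W, where a = t and b = "t + d" and c = t and \<delta> = "\<lambda>_. \<phi> t"])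
      (use \<open>d > 0\<close> 0 in \<open>auto intro!: sol sub\<close>)
  then have "t + d = t" using inj_onD[OF inj, of "t + d" t] sub \<open>d > 0\<close> by auto
  then show False using \<open>d > 0\<close> by simp
qed

lemma orbit_nonrecurrent_forward:
  fixes W :: "pt \<Rightarrow> pt"
  assumes W: "lip_field W" and J: "open J" "is_interval J" "t\<^sub>0 \<in> J" and inj: "inj_on \<phi> J"
    and sol: "\<And>t. t \<in> J \<Longrightarrow> (\<phi> has_vector_derivative W (\<phi> t)) (at t)" and "\<epsilon> > 0"
  shows "\<exists>\<eta>>0. \<forall>t\<in>J. t\<^sub>0 + \<epsilon> \<le> t \<longrightarrow> \<eta> \<le> dist (\<phi> t) (\<phi> t\<^sub>0)"
proof -
  define \<iota> where "\<iota> z = Complex (fst z) (snd z)" for z :: pt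
  define \<kappa> where "\<kappa> z = (Re z, Im z)" for z
  have [simp]: "norm (\<iota> z) = norm z" "\<iota> (x - y) = \<iota> x - \<iota> y" "\<kappa> (\<iota> z) = z" "\<iota> (\<kappa> w) = w"
     "\<iota> z = 0 \<longleftrightarrow> z = 0" "\<iota> z = \<iota> z' \<longleftrightarrow> z = z'" for x y z z' w
    by (auto simp: \<iota>_def \<kappa>_def norm_prod_def norm_complex_def complex_eq_iff prod_eq_iff)
  have \<iota>_bl: "bounded_linear \<iota>"
    by (rule bounded_linear_intro[where K = 1]) (auto simp: \<iota>_def complex_eq_iff norm_prod_def norm_complex_def)
  have \<kappa>_bl: "bounded_linear \<kappa>"
    by (rule bounded_linear_intro[where K = 1]) (auto simp: \<kappa>_def norm_prod_def norm_complex_def)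
  define w where "w = \<iota> (W (\<phi> t\<^sub>0))"
  have "w \<noteq> 0" using orbit_field_nonzero[OF W J inj sol] by (simp add: w_def)
  \<comment> \<open>Complex division by \<open>w\<close> rotates and rescales the plane so that the
    field at the base point becomes \<open>1\<close>. Distances change by the factor
    \<open>norm w\<close> only, so the bound can be carried back.\<close>
  define V where "V z = \<iota> (W (\<phi> t\<^sub>0 + \<kappa> (z * w))) / w" for z
  define \<psi> where "\<psi> t = (\<iota> (\<phi> (t + t\<^sub>0)) - \<iota> (\<phi> t\<^sub>0)) / w" for t
  define I where "I = (\<lambda>t. t + t\<^sub>0) -` J"
  have inv: "\<phi> t\<^sub>0 + \<kappa> (\<psi> t * w) = \<phi> (t + t\<^sub>0)" for t
  proof -
    have "\<kappa> (\<psi> t * w) = \<kappa> (\<iota> (\<phi> (t + t\<^sub>0) - \<phi> t\<^sub>0))" using \<open>w \<noteq> 0\<close> by (simp add: \<psi>_def)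
    also have "\<dots> = \<phi> (t + t\<^sub>0) - \<phi> t\<^sub>0" by (simp del: \<open>\<And>x y. \<iota> (x - y) = \<iota> x - \<iota> y\<close>)
    finally show ?thesis by simp
  qed
  have "\<exists>\<eta>>0. \<forall>t\<in>I. \<epsilon> \<le> t \<longrightarrow> \<eta> \<le> norm (\<psi> t)"
  proof (rule nonrecurrent_normal_form[of V])
    have "bounded_linear (\<lambda>z. \<kappa> (z * w))" "bounded_linear (\<lambda>z. \<iota> z / w)"
      by (intro bounded_linear_compose[OF \<kappa>_bl] bounded_linear_compose[OF bounded_linear_divide \<iota>_bl]
          bounded_linear_mult_left)+
    from lip_field_affine[OF W this] show "lip_field V" unfolding V_def .
    show "V 0 = 1" using \<open>w \<noteq> 0\<close> by (simp add: V_def w_def \<kappa>_def zero_prod_def[symmetric])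
    show "open I" unfolding I_def by (intro open_vimage J continuous_intros)
    show "is_interval I" using J(2) unfolding I_def is_interval_1 by (meson vimageE vimageI2 add_le_cancel_right)
    show "0 \<in> I" using J by (simp add: I_def)
    show "inj_on \<psi> I"
    proof (rule inj_onI)
      fix s t assume st: "s \<in> I" "t \<in> I" "\<psi> s = \<psi> t"
      then have "\<phi> (s + t\<^sub>0) = \<phi> (t + t\<^sub>0)" using \<open>w \<noteq> 0\<close> by (simp add: \<psi>_def)
      then show "s = t" using inj_onD[OF inj, of "s + t\<^sub>0" "t + t\<^sub>0"] st by (simp add: I_def)
    qed
    show "\<psi> 0 = 0" by (simp add: \<psi>_def)
    show "(\<psi> has_vector_derivative V (\<psi> t)) (at t)" if "t \<in> I" for t
    proof -
      have "((\<lambda>t. \<phi> (t + t\<^sub>0)) has_vector_derivative W (\<phi> (t + t\<^sub>0))) (at t)"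
        unfolding has_vector_derivative_shift_iff using sol that by (simp add: I_def)
      from bounded_linear.has_vector_derivative[OF \<iota>_bl this]
      have "((\<lambda>t. \<iota> (\<phi> (t + t\<^sub>0)) - \<iota> (\<phi> t\<^sub>0)) has_vector_derivative \<iota> (W (\<phi> (t + t\<^sub>0)))) (at t)"
        by (auto intro!: derivative_eq_intros)
      from bounded_linear.has_vector_derivative[OF bounded_linear_divide[of w] this]
      show ?thesis unfolding \<psi>_def[abs_def] V_def using inv[of t] by (simp add: \<psi>_def)
    qed
  qed fact
  then obtain \<eta> where \<eta>: "\<eta> > 0" "\<And>t. t \<in> I \<Longrightarrow> \<epsilon> \<le> t \<Longrightarrow> \<eta> \<le> norm (\<psi> t)" by blast
  have "\<eta> * norm w \<le> dist (\<phi> t) (\<phi> t\<^sub>0)" if "t \<in> J" "t\<^sub>0 + \<epsilon> \<le> t" for t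
  proof -
    have "norm (\<psi> (t - t\<^sub>0)) = dist (\<phi> t) (\<phi> t\<^sub>0) / norm w"
      by (simp add: \<psi>_def norm_divide dist_norm flip: \<open>\<And>x y. \<iota> (x - y) = \<iota> x - \<iota> y\<close>)
    moreover have "\<eta> \<le> norm (\<psi> (t - t\<^sub>0))" using \<eta>(2)[of "t - t\<^sub>0"] that by (simp add: I_def)
    ultimately show ?thesis using \<open>w \<noteq> 0\<close> by (simp add: pos_le_divide_eq)
  qed
  then show ?thesis using \<eta>(1) \<open>w \<noteq> 0\<close> by (intro exI[of _ "\<eta> * norm w"]) simp
qed

text \<open>Continuity of the inverse at a point means that orbit points close to it have close
  times. Later times are excluded by non-recurrence, earlier ones by non-recurrence of the reversed
  orbit.\<close>

lemma orbit_homeomorphism: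
  fixes W :: "pt \<Rightarrow> pt"
  assumes W: "lip_field W" and J: "open J" "is_interval J" and inj: "inj_on \<phi> J"
    and sol: "\<And>t. t \<in> J \<Longrightarrow> (\<phi> has_vector_derivative W (\<phi> t)) (at t)"
  shows "homeomorphism J (\<phi> ` J) \<phi> (inv_into J \<phi>)"
proof
  show "continuous_on J \<phi>"
    using sol by (meson continuous_at_imp_continuous_on has_vector_derivative_continuous)
  show "continuous_on (\<phi> ` J) (inv_into J \<phi>)"
    unfolding continuous_on_iff
  proof (clarsimp simp: inj)
    fix t\<^sub>0 \<epsilon> :: real assume t0: "t\<^sub>0 \<in> J" "0 < \<epsilon>"
    obtain \<eta>\<^sub>1 where \<eta>1: "\<eta>\<^sub>1 > 0" "\<And>t. t \<in> J \<Longrightarrow> t\<^sub>0 + \<epsilon> \<le> t \<Longrightarrow> \<eta>\<^sub>1 \<le> dist (\<phi> t) (\<phi> t\<^sub>0)"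
      using orbit_nonrecurrent_forward[OF W J t0(1) inj sol t0(2)] by blast
    have J': "open (uminus ` J)" "is_interval (uminus ` J)" "- t\<^sub>0 \<in> uminus ` J" 
      using J t0 open_negations by auto
    have inj': "inj_on (\<lambda>t. \<phi> (- t)) (uminus ` J)" using inj by (auto simp: inj_on_def)
    have sol': "((\<lambda>t. \<phi> (- t)) has_vector_derivative - W (\<phi> (- t))) (at t)" if "t \<in> uminus ` J" for t
    proof -
      have "- t \<in> J" using that by auto
      from has_vector_derivative_reverse[OF sol[OF this]] show ?thesis .
    qed
    obtain \<eta>\<^sub>2 where \<eta>2: "\<eta>\<^sub>2 > 0"
      "\<And>t. t \<in> uminus ` J \<Longrightarrow> - t\<^sub>0 + \<epsilon> \<le> t \<Longrightarrow> \<eta>\<^sub>2 \<le> dist (\<phi> (- t)) (\<phi> (- (- t\<^sub>0)))"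
      using orbit_nonrecurrent_forward[OF lip_field_minus[OF W] J' inj' sol' t0(2)] by blast
    have "dist t t\<^sub>0 < \<epsilon>" if "t \<in> J" "dist (\<phi> t) (\<phi> t\<^sub>0) < min \<eta>\<^sub>1 \<eta>\<^sub>2" for t
      using \<eta>1(2)[of t] \<eta>2(2)[of "- t"] that by (force simp: dist_real_def)
    then show "\<exists>d>0. \<forall>t\<in>J. dist (\<phi> t) (\<phi> t\<^sub>0) < d \<longrightarrow> dist t t\<^sub>0 < \<epsilon>"
      using \<eta>1(1) \<eta>2(1) by (intro exI[of _ "min \<eta>\<^sub>1 \<eta>\<^sub>2"]) auto
  qed
qed (use inj in \<open>auto simp: inv_into_into\<close>)

section \<open>Orbits parametrized by the real line\<close>

lemma solvesD:
  assumes "solves W \<gamma> a b"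
  shows "continuous_on {a..b} \<gamma>"
    and "\<And>s. a < s \<Longrightarrow> s < b \<Longrightarrow> (\<gamma> has_vector_derivative W (\<gamma> s)) (at s)"
proof -
  show "continuous_on {a..b} \<gamma>"
    using assms unfolding solves_def continuous_on_eq_continuous_within
    by (meson has_vector_derivative_continuous)
  show "(\<gamma> has_vector_derivative W (\<gamma> s)) (at s)" if "a < s" "s < b" for s
    using assms that unfolding solves_def by (metis at_within_Icc_at atLeastAtMost_iff less_imp_le)
qed

lemma solvesI: "(\<And>s. s \<in> {a..b} \<Longrightarrow> (\<gamma> has_vector_derivative W (\<gamma> s)) (at s)) \<Longrightarrow> solves W \<gamma> a b"
  unfolding solves_def using has_vector_derivative_at_within by blast

lemma solves_unique:
  assumes "lip_field W" "solves W \<gamma> a b" "solves W \<delta> a b" "\<gamma> c = \<delta> c" "c \<in> {a..b}" "s \<in> {a..b}"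
  shows "\<gamma> s = \<delta> s"
  using ode_unique[OF assms(1) solvesD(1)[OF assms(2)] solvesD(1)[OF assms(3)]
      solvesD(2)[OF assms(2)] solvesD(2)[OF assms(3)] assms(4-6)] by blast

lemma solves_subinterval: "solves W \<gamma> a b \<Longrightarrow> a \<le> c \<Longrightarrow> d \<le> b \<Longrightarrow> solves W \<gamma> c d"
  unfolding solves_def
  by (meson atLeastatMost_subset_iff has_vector_derivative_within_subset in_mono)

lemma solves_shift:
  assumes "solves W \<gamma> a b"
  shows "solves W (\<lambda>s. \<gamma> (s - c)) (a + c) (b + c)"
  unfolding solves_def
proof
  fix s assume s: "s \<in> {a + c..b + c}"
  have img: "(\<lambda>s. s - c) ` {a + c..b + c} = {a..b}" by (simp add: image_diff_atLeastAtMost)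
  have "((\<lambda>s. s - c) has_vector_derivative 1) (at s within {a + c..b + c})"
    by (auto intro!: derivative_eq_intros)
  moreover have "(\<gamma> has_vector_derivative W (\<gamma> (s - c))) (at (s - c) within (\<lambda>s. s - c) ` {a + c..b + c})"
    unfolding img using assms s by (auto simp: solves_def)
  ultimately show "((\<lambda>s. \<gamma> (s - c)) has_vector_derivative W (\<gamma> (s - c))) (at s within {a + c..b + c})"
    using vector_diff_chain_within[of "\<lambda>s. s - c" 1 s _ \<gamma>] by (simp add: o_def)
qed

lemma solves_join:
  assumes "solves W \<gamma> a b" "solves W \<gamma> b c" "a \<le> b" "b \<le> c"
  shows "solves W \<gamma> a c"
  unfolding solves_def
proof
  fix s assume s: "s \<in> {a..c}"
  have Un: "{a..c} = {a..b} \<union> {b..c}" using assms by auto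
  \<comment> \<open>Away from the interval the limit filter is trivial and any vector is a
    derivative. The two pieces can thus be combined uniformly, whether or not \<open>s\<close> lies
    in both.\<close>
  have far: "(\<gamma> has_vector_derivative w) (at s within {u..v})" if "s \<notin> {u..v}" for u v w
  proof -
    have "s \<notin> closure ({u..v} - {s})" using that by (simp add: closure_closed)
    then show ?thesis
      using not_in_closure_trivial_limitI unfolding has_vector_derivative_def
      by (metis at_within_eq_bot_iff has_derivative_bot bounded_linear_scaleR_left)
  qed
  have "(\<gamma> has_vector_derivative W (\<gamma> s)) (at s within {a..b})"
    "(\<gamma> has_vector_derivative W (\<gamma> s)) (at s within {b..c})"
    using assms far unfolding solves_def by blast+
  then show "(\<gamma> has_vector_derivative W (\<gamma> s)) (at s within {a..c})"
    unfolding Un has_vector_derivative_def has_derivative_within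
    using Lim_within_Un by blast
qed

lemma solves_cong: "solves W \<gamma> a b \<Longrightarrow> (\<And>s. s \<in> {a..b} \<Longrightarrow> \<gamma> s = \<delta> s) \<Longrightarrow> solves W \<delta> a b"
  unfolding solves_def by (metis has_vector_derivative_transform)

text \<open>Two-sided partial sums turn flight times into passage times; for each index at least one
  of the two sums in the witness is empty.\<close>

lemma partial_sums_int:
  fixes T :: "int \<Rightarrow> real"
  shows "\<exists>t. \<forall>i. t (i + 1) = t i + T i"
proof -
  define t where "t i = sum T {0..<i} - sum T {i..<0}" for i
  have "t (i + 1) = t i + T i" for i
  proof (cases "i \<ge> 0")
    case True
    then have "{0..<i + 1} = insert i {0..<i}" by auto
    then show ?thesis using True by (simp add: t_def)
  next
    case False
    then have "{i..<0} = insert i {i + 1..<0}" by auto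
    then show ?thesis using False by (simp add: t_def)
  qed
  then show ?thesis by blast
qed

text \<open>The parameter is an increasing rescaling of time, which leaves room to put consecutive
  two-folds at consecutive integers whatever the flight times are. The second clause turns parameter
  intervals into solutions, the third makes every solution inside \<open>A\<close> run with the
  parameter; this is the data that composes to a map of orbits.\<close>

definition orbit_param :: "(pt \<Rightarrow> pt) \<Rightarrow> pt set \<Rightarrow> (real \<Rightarrow> pt) \<Rightarrow> (pt \<Rightarrow> real) \<Rightarrow> bool" where
  "orbit_param W A a b \<longleftrightarrow> homeomorphism UNIV A a b \<and>
     (\<forall>x y. x \<le> y \<longrightarrow> (\<exists>\<delta> c d \<sigma>. c \<le> d \<and> solves W \<delta> c d \<and> strict_mono_on {x..y} \<sigma> \<and>
        \<sigma> ` {x..y} = {c..d} \<and> (\<forall>u\<in>{x..y}. a u = \<delta> (\<sigma> u)))) \<and>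
     (\<forall>\<gamma> c d. solves W \<gamma> c d \<and> \<gamma> ` {c..d} \<subseteq> A \<longrightarrow> strict_mono_on {c..d} (\<lambda>s. b (\<gamma> s)))"

lemma strict_mono_image_Icc:
  fixes \<theta> :: "real \<Rightarrow> real"
  assumes "strict_mono_on {a..b} \<theta>" "continuous_on {a..b} \<theta>" "a \<le> b"
  shows "\<theta> ` {a..b} = {\<theta> a..\<theta> b}"
proof
  have "mono_on {a..b} \<theta>" using assms(1) by (rule strict_mono_on_imp_mono_on)
  then show "\<theta> ` {a..b} \<subseteq> {\<theta> a..\<theta> b}" using assms(3) by (auto simp: mono_on_def)
  show "{\<theta> a..\<theta> b} \<subseteq> \<theta> ` {a..b}"
    using IVT'[of \<theta> a _ b] assms by fastforce
qed

text \<open>A solution in \<open>A\<close> is read through \<open>b\<close> as an increasing curve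
  of parameters. The same parameter interval on the other orbit is then rescaled to a solution, and
  \<open>\<sigma>\<close> after \<open>\<theta>\<close> is the reparametrization.\<close>

lemma orbit_param_maps_orbits:
  assumes A: "orbit_param W A a b" and A': "orbit_param W' A' a' b'" and h: "\<And>z. z \<in> A \<Longrightarrow> h z = a' (b z)"
  shows "maps_orbits W A W' A' h"
  unfolding maps_orbits_def
proof (intro allI impI, elim conjE)
  fix \<gamma> s e assume \<gamma>: "s \<le> e" "solves W \<gamma> s e" "\<gamma> ` {s..e} \<subseteq> A"
  define \<theta> where "\<theta> u = b (\<gamma> u)" for u
  have mono: "strict_mono_on {s..e} \<theta>" using A \<gamma> unfolding orbit_param_def \<theta>_def by blast
  have "continuous_on A b" using A by (simp add: orbit_param_def homeomorphism_def)
  then have cont: "continuous_on {s..e} \<theta>"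
    unfolding \<theta>_def by (rule continuous_on_compose2) (use solvesD(1) \<gamma> in auto)
  have img: "\<theta> ` {s..e} = {\<theta> s..\<theta> e}" by (rule strict_mono_image_Icc[OF mono cont \<gamma>(1)])
  have le: "\<theta> s \<le> \<theta> e" using img \<gamma>(1) by (metis atLeastAtMost_iff image_eqI order_refl)
  obtain \<delta> c d \<sigma> where \<delta>: "c \<le> d" "solves W' \<delta> c d" "strict_mono_on {\<theta> s..\<theta> e} \<sigma>"
    "\<sigma> ` {\<theta> s..\<theta> e} = {c..d}" "\<And>u. u \<in> {\<theta> s..\<theta> e} \<Longrightarrow> a' u = \<delta> (\<sigma> u)"
    using A'[unfolded orbit_param_def, THEN conjunct2, THEN conjunct1, rule_format, OF le] by blast
  have rng: "a' u \<in> A'" for u using A' by (auto simp: orbit_param_def homeomorphism_def)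
  have "\<delta> (\<sigma> u) \<in> A'" if "u \<in> {\<theta> s..\<theta> e}" for u using \<delta>(5)[OF that] rng[of u] by simp
  then have "\<delta> ` {c..d} \<subseteq> A'" unfolding \<delta>(4)[symmetric] by blast
  moreover have "strict_mono_on {s..e} (\<lambda>u. \<sigma> (\<theta> u))"
  proof (rule strict_mono_onI)
    fix u v assume uv: "u \<in> {s..e}" "v \<in> {s..e}" "u < v"
    have "\<theta> u < \<theta> v" using strict_mono_onD[OF mono uv] .
    moreover have "\<theta> u \<in> {\<theta> s..\<theta> e}" "\<theta> v \<in> {\<theta> s..\<theta> e}" using img uv by blast+
    ultimately show "\<sigma> (\<theta> u) < \<sigma> (\<theta> v)" using strict_mono_onD[OF \<delta>(3)] by blast
  qed
  moreover have "(\<lambda>u. \<sigma> (\<theta> u)) ` {s..e} = {c..d}" using img \<delta>(4) by (metis image_image)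
  moreover have "h (\<gamma> u) = \<delta> (\<sigma> (\<theta> u))" if "u \<in> {s..e}" for u
  proof -
    have "\<theta> u \<in> {\<theta> s..\<theta> e}" using img that by blast
    then have "a' (\<theta> u) = \<delta> (\<sigma> (\<theta> u))" by (rule \<delta>(5))
    moreover have "\<gamma> u \<in> A" using \<gamma>(3) that by blast
    ultimately show ?thesis using h[of "\<gamma> u"] by (simp add: \<theta>_def)
  qed
  ultimately show "\<exists>\<delta> c d \<tau>. c \<le> d \<and> solves W' \<delta> c d \<and> \<delta> ` {c..d} \<subseteq> A' \<and> strict_mono_on {s..e} \<tau> \<and>
      \<tau> ` {s..e} = {c..d} \<and> (\<forall>u\<in>{s..e}. h (\<gamma> u) = \<delta> (\<tau> u))"
    by (intro exI[of _ \<delta>] exI[of _ c] exI[of _ d] exI[of _ "\<lambda>u. \<sigma> (\<theta> u)"]) (simp add: \<delta>(1,2))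
qed

text \<open>\<open>k\<close> is a linear clock that the field advances at unit rate: it inverts
  \<open>g\<close> continuously and increases along every solution.\<close>

lemma graph_orbit_param:
  fixes g :: "real \<Rightarrow> pt" and k :: "pt \<Rightarrow> real"
  assumes der: "\<And>x. (g has_vector_derivative W (g x)) (at x)"
    and k: "bounded_linear k" "\<And>x. k (g x) = x" "\<And>z. k (W z) = 1"
  shows "orbit_param W (range g) g k"
  unfolding orbit_param_def
proof (intro conjI allI impI)
  have "continuous_on UNIV g"
    using der by (meson continuous_at_imp_continuous_on has_vector_derivative_continuous)
  then show "homeomorphism UNIV (range g) g k"
    by (rule homeomorphismI) (use k in \<open>auto simp: linear_continuous_on\<close>)
  fix x y :: real assume "x \<le> y"
  then show "\<exists>\<delta> c d \<sigma>. c \<le> d \<and> solves W \<delta> c d \<and> strict_mono_on {x..y} \<sigma> \<and>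
        \<sigma> ` {x..y} = {c..d} \<and> (\<forall>u\<in>{x..y}. g u = \<delta> (\<sigma> u))"
    using der by (intro exI[of _ g] exI[of _ x] exI[of _ y] exI[of _ "\<lambda>x. x"])
      (auto intro!: solvesI simp: strict_mono_on_def)
next
  fix \<gamma> c d assume "solves W \<gamma> c d \<and> \<gamma> ` {c..d} \<subseteq> range g"
  then have \<gamma>: "solves W \<gamma> c d" by simp
  show "strict_mono_on {c..d} (\<lambda>s. k (\<gamma> s))"
  proof (rule strict_mono_onI)
    fix s e assume se: "s \<in> {c..d}" "e \<in> {c..d}" "s < e"
    show "k (\<gamma> s) < k (\<gamma> e)"
    proof (rule DERIV_pos_imp_increasing_open[OF se(3), of "\<lambda>s. k (\<gamma> s)"])
      have "continuous_on {s..e} \<gamma>" by (rule continuous_on_subset[OF solvesD(1)[OF \<gamma>]]) (use se in auto)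
      then show "continuous_on {s..e} (\<lambda>s. k (\<gamma> s))"
        using bounded_linear.continuous_on[OF k(1)] by blast
      fix x assume "s < x" "x < e"
      then have "(\<gamma> has_vector_derivative W (\<gamma> x)) (at x)" using solvesD(2)[OF \<gamma>] se by auto
      from bounded_linear.has_vector_derivative[OF k(1) this]
      have "((\<lambda>s. k (\<gamma> s)) has_real_derivative 1) (at x)"
        by (simp add: k(3) has_real_derivative_iff_has_vector_derivative)
      then show "\<exists>y. ((\<lambda>s. k (\<gamma> s)) has_real_derivative y) (at x) \<and> y > 0" by force
    qed
  qed
qed

section \<open>The two orbits of the model\<close>

lemma P_inf_deriv: "(P_inf has_real_derivative 2 * sin (2 * pi * x)) (at x)"
  unfolding P_inf_def[abs_def] by (auto intro!: derivative_eq_intros)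

lemma upper_orbit_param: "orbit_param X_inf (range (\<lambda>x. (x, P_inf x))) (\<lambda>x. (x, P_inf x)) fst"
proof (rule graph_orbit_param)
  fix x
  have "(P_inf has_vector_derivative 2 * sin (2 * pi * x)) (at x)"
    using P_inf_deriv by (simp add: has_real_derivative_iff_has_vector_derivative)
  then show "((\<lambda>x. (x, P_inf x)) has_vector_derivative X_inf (x, P_inf x)) (at x)"
    unfolding X_inf_def by (auto intro!: has_vector_derivative_Pair derivative_eq_intros)
qed (auto simp: X_inf_def bounded_linear_fst)

text \<open>\<open>Y_inf\<close> runs to the left, so the parameter is the negative abscissa in
  order to increase with time.\<close>

lemma lower_orbit_param:
  "orbit_param Y_inf (range (\<lambda>x. (- x, - P_inf (- x)))) (\<lambda>x. (- x, - P_inf (- x))) (\<lambda>z. - fst z)"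
proof (rule graph_orbit_param)
  fix x
  have "(P_inf has_vector_derivative 2 * sin (2 * pi * (- x))) (at (- x))"
    using P_inf_deriv[of "- x"] by (simp only: has_real_derivative_iff_has_vector_derivative)
  from has_vector_derivative_minus[OF has_vector_derivative_reverse[OF this]]
  show "((\<lambda>x. (- x, - P_inf (- x))) has_vector_derivative Y_inf (- x, - P_inf (- x))) (at x)"
    unfolding Y_inf_def by (auto intro!: has_vector_derivative_Pair derivative_eq_intros)
qed (auto simp: Y_inf_def intro: bounded_linear_minus bounded_linear_fst)

section \<open>Chains of arcs\<close>

lemma xarcE:
  assumes "z \<in> xarc X f p q"
  obtains T \<gamma> s where "T > 0" "solves X \<gamma> 0 T" "\<gamma> 0 = p" "\<gamma> T = q" "\<forall>u\<in>{0<..<T}. f (\<gamma> u) > 0"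
    "s \<in> {0..T}" "z = \<gamma> s"
  using assms unfolding xarc_def by blast

text \<open>\<open>T i\<close> is the flight time of the chosen arc \<open>\<gamma> i\<close>, and
  \<open>t i\<close> the time at which the concatenated orbit passes \<open>p i\<close>. Only one
  field and one side of the manifold enter, so both halves of a loop are instances.\<close>

locale arc_chain =
  fixes X :: "pt \<Rightarrow> pt" and f :: "pt \<Rightarrow> real" and p :: "int \<Rightarrow> pt"
    and T :: "int \<Rightarrow> real" and \<gamma> :: "int \<Rightarrow> real \<Rightarrow> pt" and t :: "int \<Rightarrow> real"
  assumes X: "lip_field X" and inj_p: "inj p" and f_p: "f (p i) = 0"
    and T: "T i > 0" and \<gamma>: "solves X (\<gamma> i) 0 (T i)" and \<gamma>0: "\<gamma> i 0 = p i" and \<gamma>T: "\<gamma> i (T i) = p (i + 1)"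
    and f_pos: "0 < s \<Longrightarrow> s < T i \<Longrightarrow> f (\<gamma> i s) > 0"
    and t: "t (i + 1) = t i + T i"
begin

lemma t_less: "i < j \<Longrightarrow> t i < t j"
proof (induction j rule: int_gr_induct)
  case base
  then show ?case using t[of i] T[of i] by simp
next
  case (step j)
  then show ?case using t[of j] T[of j] by simp
qed

lemma t_le: "i \<le> j \<Longrightarrow> t i \<le> t j"
  using t_less[of i j] by (cases "i = j") auto

text \<open>The open interval between the infimum and the supremum of the passage times; either end
  may be finite.\<close>

definition J :: "real set" where "J = (\<Union>i j. {t i<..<t j})"

lemma J_open_interval: "open J" "is_interval J"
proof -
  show "open J" unfolding J_def by (intro open_UN ballI open_greaterThanLessThan)
  show "is_interval J"
    unfolding is_interval_1
  proof (intro ballI allI impI)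
    fix a b x assume ab: "a \<in> J" "b \<in> J" and x: "a \<le> x \<and> x \<le> b"
    obtain i j where "t i < a" "b < t j" using ab by (auto simp: J_def)
    then have "x \<in> {t i<..<t j}" using x by auto
    then show "x \<in> J" unfolding J_def by blast
  qed
qed

lemma Icc_sub_J: "{t i..t j} \<subseteq> J"
proof -
  have "{t i..t j} \<subseteq> {t (i - 1)<..<t (j + 1)}"
    using t_less[of "i - 1" i] t_less[of j "j + 1"] by auto
  then show ?thesis unfolding J_def by blast
qed

lemma locate:
  assumes "s \<in> J"
  obtains k where "t k \<le> s" "s < t (k + 1)"
proof -
  obtain i j where ij: "t i < s" "s < t j" using assms by (auto simp: J_def)
  have "i < j" using ij t_le[of j i] by force
  define K where "K = {k \<in> {i..j}. t k \<le> s}"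
  have "finite K" unfolding K_def by (rule finite_subset[of _ "{i..j}"]) auto
  moreover have "i \<in> K" using ij \<open>i < j\<close> by (simp add: K_def)
  ultimately have K: "Max K \<in> K" "\<And>l. l \<in> K \<Longrightarrow> l \<le> Max K" by (auto intro: Max_in)
  define k where "k = Max K"
  have k: "k \<in> K" "\<And>l. l \<in> K \<Longrightarrow> l \<le> k" using K by (auto simp: k_def)
  have ks: "k \<in> {i..j}" "t k \<le> s" using k(1) by (auto simp: K_def)
  then have "k \<noteq> j" using ij by auto
  then have "k + 1 \<in> {i..j}" using ks by auto
  moreover have "k + 1 \<notin> K" using k(2)[of "k + 1"] by auto
  ultimately have "s < t (k + 1)" by (simp add: K_def)
  with ks(2) show thesis by (rule that)
qed

lemma index_le: "t i \<le> s \<Longrightarrow> s < t (j + 1) \<Longrightarrow> i \<le> j"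
  using t_le[of "j + 1" i] by force

definition idx :: "real \<Rightarrow> int" where "idx s = (THE k. t k \<le> s \<and> s < t (k + 1))"

lemma idx: "t k \<le> s \<Longrightarrow> s < t (k + 1) \<Longrightarrow> idx s = k"
  unfolding idx_def by (rule the_equality) (auto dest: index_le intro: antisym)

definition \<phi> :: "real \<Rightarrow> pt" where "\<phi> s = \<gamma> (idx s) (s - t (idx s))"

lemma \<phi>_eq: "s \<in> {t i..t (i + 1)} \<Longrightarrow> \<phi> s = \<gamma> i (s - t i)"
proof (cases "s = t (i + 1)")
  case True
  have "idx s = i + 1" using True t_less[of "i + 1" "i + 1 + 1"] by (intro idx) auto
  then show ?thesis using True \<gamma>0[of "i + 1"] \<gamma>T[of i] t[of i] by (simp add: \<phi>_def)
next
  case False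
  assume "s \<in> {t i..t (i + 1)}"
  with False have "idx s = i" by (intro idx) auto
  then show ?thesis by (simp add: \<phi>_def)
qed

lemma \<phi>_t: "\<phi> (t i) = p i"
  using \<phi>_eq[of "t i" i] \<gamma>0 t_less[of i "i + 1"] by simp

lemma \<phi>_arc: "solves X \<phi> (t i) (t (i + 1))"
proof (rule solves_cong)
  show "solves X (\<lambda>s. \<gamma> i (s - t i)) (t i) (t (i + 1))"
    using solves_shift[OF \<gamma>[of i], of "t i"] by (simp add: t add.commute[of "T i"])
qed (simp add: \<phi>_eq)

text \<open>At a junction the incoming and the outgoing arc share the point and hence the field
  vector, so their one-sided derivatives agree. For this reason two consecutive arcs are joined
  before the derivative is taken.\<close>

lemma \<phi>_sol:
  assumes "s \<in> J"
  shows "(\<phi> has_vector_derivative X (\<phi> s)) (at s)"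
proof -
  obtain k where k: "t k \<le> s" "s < t (k + 1)" using locate[OF assms] .
  have "solves X \<phi> (t (k - 1)) (t (k + 1))"
    using solves_join[OF _ \<phi>_arc[of k]] \<phi>_arc[of "k - 1"] t_le[of "k - 1" k] t_le[of k "k + 1"] by simp
  moreover have "t (k - 1) < s" using t_less[of "k - 1" k] k by simp
  ultimately show ?thesis using solvesD(2) k(2) by blast
qed

lemma f_\<phi>:
  assumes "s \<in> J"
  shows "f (\<phi> s) \<ge> 0" "f (\<phi> s) = 0 \<Longrightarrow> \<exists>i. s = t i"
proof -
  obtain k where k: "t k \<le> s" "s < t (k + 1)" using locate[OF assms] .
  have "f (\<phi> s) > 0" if "s \<noteq> t k"
    using f_pos[of "s - t k" k] k that \<phi>_eq[of s k] by (simp add: t)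
  moreover have "f (\<phi> s) = 0" if "s = t k" using that by (simp add: \<phi>_t f_p)
  ultimately show "f (\<phi> s) \<ge> 0" "f (\<phi> s) = 0 \<Longrightarrow> \<exists>i. s = t i" by (cases "s = t k"; force)+
qed

text \<open>If two points of the orbit coincide, then so do the next points of the switching manifold.\<close>

lemma \<phi>_inj: "inj_on \<phi> J"
proof (rule linorder_inj_onI')
  fix s u assume su: "s \<in> J" "u \<in> J" "s < u"
  show "\<phi> s \<noteq> \<phi> u"
  proof
    assume eq: "\<phi> s = \<phi> u"
    obtain i where i: "t i \<le> s" "s < t (i + 1)" using locate[OF su(1)] .
    obtain j where j: "t j \<le> u" "u < t (j + 1)" using locate[OF su(2)] .
    \<comment> \<open>The waiting time until one of the two coinciding copies completes its arc.
      Both are then at the same zero of \<open>f\<close>, hence at passage times of the same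
      two-fold.\<close>
    define d where "d = min (t (i + 1) - s) (t (j + 1) - u)"
    have "d > 0" using i j by (simp add: d_def)
    have subJ: "s + x \<in> J" "u + x \<in> J" if "0 \<le> x" "x \<le> d" for x
      using that i j Icc_sub_J[of i "i + 1"] Icc_sub_J[of j "j + 1"] by (auto simp: d_def)
    have "solves X \<phi> s (s + d)" "solves X \<phi> u (u + d)"
      using subJ[of "_ - s"] subJ[of "_ - u"] by (auto intro!: solvesI \<phi>_sol)
    then have "solves X (\<lambda>x. \<phi> (x - - s)) 0 d" "solves X (\<lambda>x. \<phi> (x - - u)) 0 d"
      using solves_shift[of X \<phi> s "s + d" "- s"] solves_shift[of X \<phi> u "u + d" "- u"] by simp_all
    from solves_unique[OF X this, of 0 d] have eqd: "\<phi> (s + d) = \<phi> (u + d)"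
      using eq \<open>d > 0\<close> by (simp add: add.commute)
    have "s + d = t (i + 1) \<or> u + d = t (j + 1)" by (auto simp: d_def)
    then have "f (\<phi> (s + d)) = 0" using eqd \<phi>_t f_p by metis
    then obtain k l where kl: "s + d = t k" "u + d = t l"
      using f_\<phi>(2)[of "s + d"] f_\<phi>(2)[of "u + d"] subJ[of d] eqd \<open>d > 0\<close> by auto
    then have "p k = p l" using eqd \<phi>_t by metis
    then have "k = l" using inj_p by (simp add: inj_eq)
    then show False using kl su by simp
  qed
qed

text \<open>\<open>xarc\<close> collects the points of all connecting solutions. Uniqueness leaves
  only one for each pair of consecutive two-folds, so the chosen arcs already give the whole
  set.\<close>

lemma arcs_eq: "(\<Union>i. xarc X f (p i) (p (i + 1))) = \<phi> ` J"
proof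
  show "\<phi> ` J \<subseteq> (\<Union>i. xarc X f (p i) (p (i + 1)))"
  proof (rule image_subsetI)
    fix s assume "s \<in> J"
    then obtain k where k: "t k \<le> s" "s < t (k + 1)" by (rule locate)
    then have "\<phi> s = \<gamma> k (s - t k)" "s - t k \<in> {0..T k}" using \<phi>_eq[of s k] by (auto simp: t)
    then have "\<phi> s \<in> xarc X f (p k) (p (k + 1))"
      unfolding xarc_def
      by (intro CollectI exI[of _ "T k"] exI[of _ "\<gamma> k"] exI[of _ "s - t k"])
        (simp add: T \<gamma> \<gamma>0 \<gamma>T f_pos)
    then show "\<phi> s \<in> (\<Union>i. xarc X f (p i) (p (i + 1)))" by blast
  qed
  show "(\<Union>i. xarc X f (p i) (p (i + 1))) \<subseteq> \<phi> ` J"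
  proof
    fix z assume "z \<in> (\<Union>i. xarc X f (p i) (p (i + 1)))"
    then obtain i where "z \<in> xarc X f (p i) (p (i + 1))" by (rule UN_E) (rule that)
    then obtain S \<delta> s where \<delta>: "S > 0" "solves X \<delta> 0 S" "\<delta> 0 = p i" "\<delta> S = p (i + 1)"
      "\<forall>u\<in>{0<..<S}. f (\<delta> u) > 0" and s: "s \<in> {0..S}" "z = \<delta> s"
      by (rule xarcE)
    have eq: "\<delta> u = \<gamma> i u" if "u \<in> {0..min S (T i)}" for u
      using solves_unique[OF X solves_subinterval[OF \<delta>(2)] solves_subinterval[OF \<gamma>[of i]],
          of 0 "min S (T i)" 0 u] that \<delta>(1,3) T[of i] \<gamma>0[of i] by auto
    \<comment> \<open>A shorter flight would place its endpoint, where \<open>f\<close> vanishes, at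
      an interior time of the longer one, where \<open>f\<close> is positive.\<close>
    have "S = T i"
    proof (rule linorder_cases[of S "T i"])
      assume "S < T i"
      then show ?thesis using eq[of S] \<delta>(1,4) f_p[of "i + 1"] f_pos[of S i] by simp
    next
      assume "T i < S"
      then show ?thesis using eq[of "T i"] bspec[OF \<delta>(5), of "T i"] T[of i] \<gamma>T[of i] f_p[of "i + 1"] by simp
    qed
    then have "z = \<phi> (t i + s)" "t i + s \<in> {t i..t (i + 1)}"
      using s eq[of s] \<phi>_eq[of "t i + s" i] by (auto simp: t)
    then show "z \<in> \<phi> ` J" using Icc_sub_J[of i "i + 1"] by blast
  qed
qed

text \<open>Affine from each unit interval between integers onto the time interval of the
  corresponding arc, so that integers become passage times.\<close>

definition \<tau> :: "real \<Rightarrow> real" where "\<tau> x = t \<lfloor>x\<rfloor> + frac x * T \<lfloor>x\<rfloor>"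

lemma \<tau>_bounds: "t \<lfloor>x\<rfloor> \<le> \<tau> x" "\<tau> x < t (\<lfloor>x\<rfloor> + 1)"
  using T[of "\<lfloor>x\<rfloor>"] frac_lt_1[of x] by (auto simp: \<tau>_def t)

lemma \<tau>_strict_mono: "strict_mono \<tau>"
proof (rule strict_monoI)
  fix x y :: real assume "x < y"
  show "\<tau> x < \<tau> y"
  proof (cases "\<lfloor>x\<rfloor> = \<lfloor>y\<rfloor>")
    case True
    then show ?thesis using \<open>x < y\<close> T by (simp add: \<tau>_def frac_def)
  next
    case False
    then have "\<lfloor>x\<rfloor> + 1 \<le> \<lfloor>y\<rfloor>" using floor_mono[of x y] \<open>x < y\<close> by simp
    then have "t (\<lfloor>x\<rfloor> + 1) \<le> t \<lfloor>y\<rfloor>" by (rule t_le)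
    then show ?thesis using \<tau>_bounds(2)[of x] \<tau>_bounds(1)[of y] by linarith
  qed
qed

lemma \<tau>_range: "range \<tau> = J"
proof
  show "range \<tau> \<subseteq> J"
  proof clarify
    fix x
    have "\<tau> x \<in> {t \<lfloor>x\<rfloor>..t (\<lfloor>x\<rfloor> + 1)}" using \<tau>_bounds[of x] by simp
    then show "\<tau> x \<in> J" using Icc_sub_J by blast
  qed
  show "J \<subseteq> range \<tau>"
  proof
    fix s assume "s \<in> J"
    then obtain k where k: "t k \<le> s" "s < t (k + 1)" by (rule locate)
    define x where "x = of_int k + (s - t k) / T k"
    have "0 \<le> (s - t k) / T k" "(s - t k) / T k < 1" using k T[of k] by (auto simp: t)
    then have "\<lfloor>x\<rfloor> = k" unfolding x_def by linarith
    then have "\<tau> x = s" using T[of k] by (simp add: \<tau>_def frac_def x_def)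
    then show "s \<in> range \<tau>" by blast
  qed
qed

lemma \<tau>_homeo: "homeomorphism UNIV J \<tau> (inv \<tau>)"
proof (rule homeomorphismI)
  have inj: "inj \<tau>" using \<tau>_strict_mono by (rule strict_mono_imp_inj_on)
  show "continuous_on UNIV \<tau>"
    by (rule continuous_onI_mono) (use J_open_interval \<tau>_range \<tau>_strict_mono in \<open>auto simp: strict_mono_less_eq\<close>)
  show "continuous_on J (inv \<tau>)"
  proof (rule continuous_onI_mono)
    have "inv \<tau> ` J = UNIV" unfolding \<tau>_range[symmetric] using inj by (auto simp: image_iff)
    then show "open (inv \<tau> ` J)" by simp
    fix x y assume "x \<in> J" "y \<in> J" "x \<le> y"
    then show "inv \<tau> x \<le> inv \<tau> y"
      using \<tau>_strict_mono \<tau>_range f_inv_into_f by (metis strict_mono_less_eq)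
  qed
qed (use \<tau>_range \<tau>_strict_mono in \<open>auto simp: f_inv_into_f strict_mono_imp_inj_on inv_f_f\<close>)

text \<open>Any solution inside the orbit is a time translate of \<open>\<phi>\<close>.\<close>

lemma solution_in_orbit:
  assumes \<delta>: "solves X \<delta> c d" "\<delta> ` {c..d} \<subseteq> \<phi> ` J"
  shows "strict_mono_on {c..d} (\<lambda>s. inv_into J \<phi> (\<delta> s))"
proof -
  define \<sigma> where "\<sigma> s = inv_into J \<phi> (\<delta> s)" for s
  have \<sigma>: "\<sigma> s \<in> J" "\<phi> (\<sigma> s) = \<delta> s" if "s \<in> {c..d}" for s
    using \<delta>(2) that unfolding \<sigma>_def by (auto intro!: inv_into_into f_inv_into_f)
  \<comment> \<open>Near each \<open>s\<close> uniqueness matches \<open>\<delta>\<close> with a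
    translate of \<open>\<phi>\<close>, and injectivity of \<open>\<phi>\<close> then shows that
    \<open>\<sigma> u - u\<close> is locally constant. A zero derivative on an interval makes it
    constant.\<close>
  have "\<exists>k. \<forall>s\<in>{c..d}. \<sigma> s - s = k"
  proof (rule has_field_derivative_zero_constant)
    fix s assume s: "s \<in> {c..d}"
    obtain \<rho> where \<rho>: "\<rho> > 0" "cball (\<sigma> s) \<rho> \<subseteq> J"
      using J_open_interval(1) \<sigma>(1)[OF s] open_contains_cball by blast
    have loc: "\<sigma> u - u = \<sigma> s - s" if u: "u \<in> {c..d}" "dist u s < \<rho>" for u
    proof -
      define a b where "a = max c (s - \<rho>)" and "b = min d (s + \<rho>)"
      have mem: "x - (s - \<sigma> s) \<in> J" if "x \<in> {a..b}" for x
        using \<rho>(2) that by (auto simp: a_def b_def dist_real_def subset_iff)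
      define k where "k = s - \<sigma> s"
      have "solves X \<phi> (a - k) (b - k)"
      proof (intro solvesI \<phi>_sol)
        show "x \<in> J" if "x \<in> {a - k..b - k}" for x using mem[of "x + k"] that by (simp add: k_def)
      qed
      from solves_shift[OF this, of k] have \<phi>: "solves X (\<lambda>x. \<phi> (x - k)) a b" by simp
      have sub: "solves X \<delta> a b" by (rule solves_subinterval[OF \<delta>(1)]) (auto simp: a_def b_def)
      have su: "s \<in> {a..b}" "u \<in> {a..b}" using u s \<rho>(1) by (auto simp: a_def b_def dist_real_def)
      have "\<delta> s = \<phi> (s - k)" using \<sigma>(2)[OF s] by (simp add: k_def)
      from solves_unique[OF X sub \<phi> this su] have "\<delta> u = \<phi> (u - (s - \<sigma> s))" by (simp add: k_def)
      moreover have "u - (s - \<sigma> s) \<in> J" using mem[OF su(2)] .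
      ultimately show ?thesis using \<phi>_inj by (simp add: \<sigma>_def inv_into_f_f)
    qed
    show "((\<lambda>s. \<sigma> s - s) has_field_derivative 0) (at s within {c..d})"
    proof (rule has_field_derivative_transform_within[OF _ \<rho>(1) s])
      show "((\<lambda>_. \<sigma> s - s) has_field_derivative 0) (at s within {c..d})" by simp
      show "\<sigma> s - s = \<sigma> u - u" if "u \<in> {c..d}" "dist u s < \<rho>" for u using loc[OF that] by simp
    qed
  qed simp
  then obtain k where "\<And>s. s \<in> {c..d} \<Longrightarrow> \<sigma> s - s = k" by blast
  then have "\<sigma> s = s + k" if "s \<in> {c..d}" for s using that by (simp add: diff_eq_eq add.commute)
  then show ?thesis unfolding \<sigma>_def[symmetric] by (simp add: strict_mono_on_def)
qed

lemma orbit_param: "orbit_param X (\<phi> ` J) (\<phi> \<circ> \<tau>) (inv \<tau> \<circ> inv_into J \<phi>)"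
  unfolding orbit_param_def
proof (intro conjI allI impI)
  show "homeomorphism UNIV (\<phi> ` J) (\<phi> \<circ> \<tau>) (inv \<tau> \<circ> inv_into J \<phi>)"
    by (rule homeomorphism_compose[OF \<tau>_homeo orbit_homeomorphism[OF X J_open_interval \<phi>_inj \<phi>_sol]])
  fix x y :: real assume "x \<le> y"
  have \<tau>xy: "\<tau> ` {x..y} = {\<tau> x..\<tau> y}"
    using \<tau>_homeo \<tau>_strict_mono \<open>x \<le> y\<close>
    by (intro strict_mono_image_Icc)
      (auto simp: homeomorphism_def strict_mono_on_def strict_mono_def intro: continuous_on_subset)
  show "\<exists>\<delta> c d \<sigma>. c \<le> d \<and> solves X \<delta> c d \<and> strict_mono_on {x..y} \<sigma> \<and>
      \<sigma> ` {x..y} = {c..d} \<and> (\<forall>u\<in>{x..y}. (\<phi> \<circ> \<tau>) u = \<delta> (\<sigma> u))"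
  proof (intro exI conjI)
    show "\<tau> x \<le> \<tau> y" using \<tau>_strict_mono \<open>x \<le> y\<close> by (simp add: strict_mono_less_eq)
    show "\<tau> ` {x..y} = {\<tau> x..\<tau> y}" by fact
    have "{\<tau> x..\<tau> y} \<subseteq> J" using \<tau>xy \<tau>_range by blast
    then show "solves X \<phi> (\<tau> x) (\<tau> y)" by (auto intro!: solvesI \<phi>_sol)
    show "strict_mono_on {x..y} \<tau>" using \<tau>_strict_mono by (simp add: strict_mono_on_def strict_mono_def)
  qed simp
next
  fix \<delta> c d assume \<delta>: "solves X \<delta> c d \<and> \<delta> ` {c..d} \<subseteq> \<phi> ` J"
  have "strict_mono_on J (inv \<tau>)"
    using \<tau>_strict_mono \<tau>_range by (metis (no_types, lifting) f_inv_into_f strict_mono_less strict_mono_onI)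
  moreover have "inv_into J \<phi> (\<delta> s) \<in> J" if "s \<in> {c..d}" for s
    using \<delta> that by (auto intro!: inv_into_into)
  ultimately show "strict_mono_on {c..d} (\<lambda>s. (inv \<tau> \<circ> inv_into J \<phi>) (\<delta> s))"
    using solution_in_orbit[of \<delta> c d] \<delta> by (auto simp: strict_mono_on_def)
qed

lemma \<phi>_\<tau>_int: "(\<phi> \<circ> \<tau>) (of_int i) = p i"
  by (simp add: \<tau>_def \<phi>_t)

end

lemma arc_chain_param:
  assumes X: "lip_field X" and "inj p" "\<And>i. f (p i) = 0" and ne: "\<And>i. xarc X f (p i) (p (i + 1)) \<noteq> {}"
    and A: "A = (\<Union>i. xarc X f (p i) (p (i + 1)))"
  obtains a b where "orbit_param X A a b" "\<And>i. a (of_int i) = p i"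
    "\<And>z. z \<in> A \<Longrightarrow> f z \<ge> 0" "\<And>z. z \<in> A \<Longrightarrow> f z = 0 \<Longrightarrow> z \<in> range p"
proof -
  have "\<forall>i. \<exists>S \<delta>. S > 0 \<and> solves X \<delta> 0 S \<and> \<delta> 0 = p i \<and> \<delta> S = p (i + 1) \<and> (\<forall>u\<in>{0<..<S}. f (\<delta> u) > 0)"
  proof
    fix i
    obtain z where "z \<in> xarc X f (p i) (p (i + 1))" using ne[of i] by blast
    then show "\<exists>S \<delta>. S > 0 \<and> solves X \<delta> 0 S \<and> \<delta> 0 = p i \<and> \<delta> S = p (i + 1) \<and> (\<forall>u\<in>{0<..<S}. f (\<delta> u) > 0)"
      by (rule xarcE) blast
  qed
  from choice[OF this] obtain T where "\<forall>i. \<exists>\<delta>. T i > 0 \<and> solves X \<delta> 0 (T i) \<and> \<delta> 0 = p i \<and> \<delta> (T i) = p (i + 1) \<and>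
      (\<forall>u\<in>{0<..<T i}. f (\<delta> u) > 0)" by (rule exE)
  from choice[OF this] obtain \<gamma> where T: "\<forall>i. T i > 0 \<and> solves X (\<gamma> i) 0 (T i) \<and> \<gamma> i 0 = p i \<and> \<gamma> i (T i) = p (i + 1) \<and>
      (\<forall>u\<in>{0<..<T i}. f (\<gamma> i u) > 0)" by (rule exE)
  obtain t where "\<forall>i. t (i + 1) = t i + T i" using partial_sums_int[of T] by (rule exE)
  then interpret arc_chain X f p T \<gamma> t using assms T by unfold_locales auto
  show thesis
  proof (rule that)
    show "orbit_param X A (\<phi> \<circ> \<tau>) (inv \<tau> \<circ> inv_into J \<phi>)" using orbit_param by (simp add: A arcs_eq)
    show "(\<phi> \<circ> \<tau>) (of_int i) = p i" for i by (rule \<phi>_\<tau>_int)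
    show "f z \<ge> 0" "f z = 0 \<Longrightarrow> z \<in> range p" if "z \<in> A" for z
      using that f_\<phi> \<phi>_t unfolding A arcs_eq by (auto, metis rangeI)
  qed
qed

section \<open>Gluing the two orbits of a loop\<close>

text \<open>The data of a loop from which the equivalence is built. The two orbits visit the
  two-folds in opposite order, whence the sign in \<open>c (- of_int i)\<close>; disjointness from
  the sliding and escaping set makes the orbit conditions for the sliding field vacuous.\<close>

definition loop_param ::
  "(pt \<Rightarrow> pt) \<Rightarrow> (pt \<Rightarrow> pt) \<Rightarrow> (pt \<Rightarrow> real) \<Rightarrow> pt set \<Rightarrow>
   (real \<Rightarrow> pt) \<Rightarrow> (pt \<Rightarrow> real) \<Rightarrow> (real \<Rightarrow> pt) \<Rightarrow> (pt \<Rightarrow> real) \<Rightarrow> bool" where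
  "loop_param X Y f L a b c d \<longleftrightarrow>
     orbit_param X (L \<inter> {z. f z \<ge> 0}) a b \<and> orbit_param Y (L \<inter> {z. f z \<le> 0}) c d \<and>
     (\<forall>i::int. a (of_int i) = c (- of_int i)) \<and>
     L \<inter> {z. f z = 0} = range (\<lambda>i::int. a (of_int i)) \<and>
     L \<inter> sliding_or_escaping X Y f = {} \<and> continuous_on UNIV f"

definition transfer_map where
  "transfer_map f b d a' c' z = (if f z \<le> (0::real) then c' (d z) else a' (b z))"

lemma orbit_paramD:
  assumes "orbit_param W A a b"
  shows "\<And>x. b (a x) = x" "\<And>z. z \<in> A \<Longrightarrow> a (b z) = z" "\<And>x. a x \<in> A"
    "continuous_on A (\<lambda>z. b z)" "continuous_on UNIV a"
  using assms by (auto simp: orbit_param_def homeomorphism_def)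

text \<open>The halves are closed in \<open>L\<close> by continuity of \<open>f\<close> and overlap
  in the two-folds. There the two formulas agree, because in both loops the upper parameter
  \<open>i\<close> and the lower parameter \<open>- i\<close> name the same point. Continuity
  follows by pasting.\<close>

lemma transfer_map:
  assumes L: "loop_param X Y f L a b c d" and L': "loop_param X' Y' f' L' a' b' c' d'"
  defines "h \<equiv> transfer_map f b d a' c'"
  shows "\<And>z. z \<in> L \<inter> {z. f z \<ge> 0} \<Longrightarrow> h z = a' (b z)"
    and "\<And>z. z \<in> L \<inter> {z. f z \<le> 0} \<Longrightarrow> h z = c' (d z)"
    and "continuous_on L h" "h ` L \<subseteq> L'"
    and "h ` (L \<inter> {z. f z = 0}) \<subseteq> L' \<inter> {z. f' z = 0}"
proof -
  have X: "orbit_param X (L \<inter> {z. f z \<ge> 0}) a b" and Y: "orbit_param Y (L \<inter> {z. f z \<le> 0}) c d"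
    and ac: "\<And>i::int. a (of_int i) = c (- of_int i)"
    and \<Sigma>: "L \<inter> {z. f z = 0} = range (\<lambda>i::int. a (of_int i))" and f: "continuous_on UNIV f"
    using L by (auto simp: loop_param_def)
  have X': "orbit_param X' (L' \<inter> {z. f' z \<ge> 0}) a' b'" and Y': "orbit_param Y' (L' \<inter> {z. f' z \<le> 0}) c' d'"
    and ac': "\<And>i::int. a' (of_int i) = c' (- of_int i)"
    and \<Sigma>': "L' \<inter> {z. f' z = 0} = range (\<lambda>i::int. a' (of_int i))"
    using L' by (auto simp: loop_param_def)
  have \<Sigma>b: "\<exists>i::int. b z = of_int i \<and> d z = - of_int i" if z: "z \<in> L" "f z = 0" for z
  proof -
    have "z \<in> L \<inter> {z. f z = 0}" using z by simp
    then obtain i :: int where i: "z = a (of_int i)" unfolding \<Sigma> by blast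
    have "b z = of_int i" unfolding i by (rule orbit_paramD(1)[OF X])
    moreover have "d z = - of_int i" unfolding i ac by (rule orbit_paramD(1)[OF Y])
    ultimately show ?thesis by blast
  qed
  have agree: "a' (b z) = c' (d z)" if "z \<in> L" "f z = 0" for z
    using \<Sigma>b[OF that] ac' by auto
  show pos: "h z = a' (b z)" if "z \<in> L \<inter> {z. f z \<ge> 0}" for z
    using that agree by (simp add: h_def transfer_map_def)
  show neg: "h z = c' (d z)" if "z \<in> L \<inter> {z. f z \<le> 0}" for z
    using that by (simp add: h_def transfer_map_def)
  show "continuous_on L h"
    unfolding h_def transfer_map_def[abs_def]
  proof (rule continuous_on_cases_le)
    have "continuous_on (L \<inter> {z. f z \<le> 0}) (\<lambda>z. c' (d z))"
      by (rule continuous_on_compose2[OF orbit_paramD(5)[OF Y'] orbit_paramD(4)[OF Y]]) simp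
    then show "continuous_on {z \<in> L. f z \<le> 0} (\<lambda>z. c' (d z))" by (simp add: Int_def)
    have "continuous_on (L \<inter> {z. f z \<ge> 0}) (\<lambda>z. a' (b z))"
      by (rule continuous_on_compose2[OF orbit_paramD(5)[OF X'] orbit_paramD(4)[OF X]]) simp
    then show "continuous_on {z \<in> L. 0 \<le> f z} (\<lambda>z. a' (b z))" by (simp add: Int_def)
    show "continuous_on L f" using f continuous_on_subset by blast
  qed (simp add: agree)
  show "h ` L \<subseteq> L'"
    using orbit_paramD(3)[OF X'] orbit_paramD(3)[OF Y'] by (auto simp: h_def transfer_map_def)
  show "h ` (L \<inter> {z. f z = 0}) \<subseteq> L' \<inter> {z. f' z = 0}"
  proof (rule image_subsetI)
    fix z assume z: "z \<in> L \<inter> {z. f z = 0}"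
    then obtain i :: int where "b z = of_int i" using \<Sigma>b by blast
    then have "h z = a' (of_int i)" using pos[of z] z by simp
    then show "h z \<in> L' \<inter> {z. f' z = 0}" unfolding \<Sigma>' by simp
  qed
qed

text \<open>Each half goes to the corresponding half, so the way back uses the same branch or, at a
  two-fold, one that agrees with it.\<close>

lemma transfer_map_inverse:
  assumes L: "loop_param X Y f L a b c d" and L': "loop_param X' Y' f' L' a' b' c' d'" and z: "z \<in> L"
  shows "transfer_map f' b' d' a c (transfer_map f b d a' c' z) = z"
proof (cases "f z \<le> 0")
  case True
  have Y: "orbit_param Y (L \<inter> {z. f z \<le> 0}) c d" "orbit_param Y' (L' \<inter> {z. f' z \<le> 0}) c' d'"
    using L L' by (auto simp: loop_param_def)
  then show ?thesis
    using True z transfer_map(2)[OF L L', of z] transfer_map(2)[OF L' L, of "c' (d z)"]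
      orbit_paramD(1,3)[OF Y(2)] orbit_paramD(2)[OF Y(1), of z] by simp
next
  case False
  have X: "orbit_param X (L \<inter> {z. f z \<ge> 0}) a b" "orbit_param X' (L' \<inter> {z. f' z \<ge> 0}) a' b'"
    using L L' by (auto simp: loop_param_def)
  then show ?thesis
    using False z transfer_map(1)[OF L L', of z] transfer_map(1)[OF L' L, of "a' (b z)"]
      orbit_paramD(1,3)[OF X(2)] orbit_paramD(2)[OF X(1), of z] by simp
qed

lemma loop_param_sigma_equiv:
  assumes L: "loop_param X Y f L a b c d" and L': "loop_param X' Y' f' L' a' b' c' d'"
  shows "sigma_equiv X Y f L X' Y' f' L'"
proof -
  define h where "h = transfer_map f b d a' c'"
  define g where "g = transfer_map f' b' d' a c"
  note h = transfer_map[OF L L', folded h_def] and g = transfer_map[OF L' L, folded g_def]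
  note gh = transfer_map_inverse[OF L L', folded h_def g_def]
  note hg = transfer_map_inverse[OF L' L, folded h_def g_def]
  have trivial: "maps_orbits W {} W' A' k" for W W' A' k
    unfolding maps_orbits_def by auto
  have X: "orbit_param X (L \<inter> {z. f z \<ge> 0}) a b" "orbit_param X' (L' \<inter> {z. f' z \<ge> 0}) a' b'"
    and Y: "orbit_param Y (L \<inter> {z. f z \<le> 0}) c d" "orbit_param Y' (L' \<inter> {z. f' z \<le> 0}) c' d'"
    and S: "L \<inter> sliding_or_escaping X Y f = {}" "L' \<inter> sliding_or_escaping X' Y' f' = {}"
    using L L' by (auto simp: loop_param_def)
  have "homeomorphism L L' h g"
    by (rule homeomorphismI) (use h(3,4) g(3,4) gh hg in auto)
  moreover have "h ` (L \<inter> {z. f z = 0}) = L' \<inter> {z. f' z = 0}"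
  proof
    show "L' \<inter> {z. f' z = 0} \<subseteq> h ` (L \<inter> {z. f z = 0})"
    proof
      fix w assume w: "w \<in> L' \<inter> {z. f' z = 0}"
      then have "g w \<in> L \<inter> {z. f z = 0}" using g(5) by blast
      moreover have "w = h (g w)" using hg w by simp
      ultimately show "w \<in> h ` (L \<inter> {z. f z = 0})" by blast
    qed
  qed (rule h(5))
  moreover note orbit_param_maps_orbits[OF X(1,2) h(1)] orbit_param_maps_orbits[OF X(2,1) g(1)]
    orbit_param_maps_orbits[OF Y(1,2) h(2)] orbit_param_maps_orbits[OF Y(2,1) g(2)]
  ultimately show ?thesis
    unfolding sigma_equiv_def S by (intro exI[of _ h] exI[of _ g] conjI trivial)
qed

section \<open>The model set as a parametrized loop\<close>

lemma P_inf_nonneg: "P_inf x \<ge> 0"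
  by (simp add: P_inf_def)

lemma P_inf_eq_0_iff: "P_inf x = 0 \<longleftrightarrow> (\<exists>i::int. x = of_int i)"
proof -
  have "P_inf x = 0 \<longleftrightarrow> cos (2 * pi * x) = 1" by (simp add: P_inf_def)
  also have "\<dots> \<longleftrightarrow> (\<exists>i::int. 2 * pi * x = of_int i * 2 * pi)" by (rule cos_one_2pi_int)
  also have "\<dots> \<longleftrightarrow> (\<exists>i::int. x = of_int i)" by (simp add: mult.commute[of x] mult.assoc)
  finally show ?thesis .
qed

lemma lie_f_inf: "lie f_inf W z = snd (W z)"
proof -
  have "(f_inf has_derivative snd) (at z)"
    unfolding f_inf_def[abs_def] by (rule bounded_linear_imp_has_derivative[OF bounded_linear_snd])
  then show ?thesis by (simp add: lie_def frechet_derivative_at[symmetric])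
qed

lemma model_loop_param:
  "loop_param X_inf Y_inf f_inf Lambda_inf (\<lambda>x. (x, P_inf x)) fst (\<lambda>x. (- x, - P_inf (- x))) (\<lambda>z. - fst z)"
proof -
  have mem: "(x, y) \<in> Lambda_inf \<longleftrightarrow> y = P_inf x \<or> y = - P_inf x" for x y
    by (auto simp: Lambda_inf_def)
  have upper: "Lambda_inf \<inter> {z. f_inf z \<ge> 0} = range (\<lambda>x. (x, P_inf x))"
  proof (rule set_eqI)
    fix z :: pt
    obtain x y where z: "z = (x, y)" by (rule prod.exhaust)
    have "z \<in> range (\<lambda>x. (x, P_inf x)) \<longleftrightarrow> y = P_inf x" by (auto simp: z)
    then show "z \<in> Lambda_inf \<inter> {z. f_inf z \<ge> 0} \<longleftrightarrow> z \<in> range (\<lambda>x. (x, P_inf x))"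
      using P_inf_nonneg[of x] by (auto simp: z mem f_inf_def)
  qed
  have lower: "Lambda_inf \<inter> {z. f_inf z \<le> 0} = range (\<lambda>x. (- x, - P_inf (- x)))"
  proof (rule set_eqI)
    fix z :: pt
    obtain x y where z: "z = (x, y)" by (rule prod.exhaust)
    have "z \<in> range (\<lambda>x. (- x, - P_inf (- x))) \<longleftrightarrow> y = - P_inf x"
      by (auto simp: z intro: range_eqI[of _ _ "- x"])
    then show "z \<in> Lambda_inf \<inter> {z. f_inf z \<le> 0} \<longleftrightarrow> z \<in> range (\<lambda>x. (- x, - P_inf (- x)))"
      using P_inf_nonneg[of x] by (auto simp: z mem f_inf_def)
  qed
  have P0: "P_inf (of_int i) = 0" for i :: int using P_inf_eq_0_iff by blast
  have \<Sigma>: "Lambda_inf \<inter> {z. f_inf z = 0} = range (\<lambda>i::int. (of_int i, P_inf (of_int i)))"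
  proof (rule set_eqI)
    fix z :: pt
    obtain x y where z: "z = (x, y)" by (rule prod.exhaust)
    have "z \<in> Lambda_inf \<inter> {z. f_inf z = 0} \<longleftrightarrow> y = 0 \<and> P_inf x = 0" by (auto simp: z mem f_inf_def)
    also have "\<dots> \<longleftrightarrow> z \<in> range (\<lambda>i::int. (of_int i, P_inf (of_int i)))"
      by (auto simp: z P_inf_eq_0_iff P0)
    finally show "z \<in> Lambda_inf \<inter> {z. f_inf z = 0} \<longleftrightarrow> \<dots>" .
  qed
  \<comment> \<open>Both model fields have the same vertical component, so their Lie derivatives
    never have opposite signs.\<close>
  have slide: "sliding_or_escaping X_inf Y_inf f_inf = {}"
    by (auto simp: sliding_or_escaping_def lie_f_inf X_inf_def Y_inf_def)
  have cont: "continuous_on UNIV f_inf"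
    unfolding f_inf_def[abs_def] by (intro continuous_intros)
  show ?thesis
    unfolding loop_param_def upper lower \<Sigma> slide
    using upper_orbit_param lower_orbit_param cont P0 by simp
qed

section \<open>An arbitrary loop as a parametrized loop\<close>

lemma yarc_eq_xarc: "yarc Y f p q = xarc Y (\<lambda>z. - f z) p q"
  by (simp add: yarc_def xarc_def)

lemma loop_loop_param:
  assumes Z: "psvf X Y f" and loop: "infty_homoclinic_loop X Y f p"
  obtains a b c d where "loop_param X Y f (loop_set X Y f p) a b c d"
proof -
  \<comment> \<open>The lower arcs are upper arcs for \<open>Y\<close>, \<open>- f\<close> and the two-folds in reverse order.\<close>
  define A where "A = (\<Union>i. xarc X f (p i) (p (i + 1)))"
  define q where "q i = p (- i)" for i
  define B where "B = (\<Union>i. xarc Y (\<lambda>z. - f z) (q i) (q (i + 1)))"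
  have inj: "inj p" and fold: "\<And>i. vv_two_fold X Y f (p i)"
    and ne: "\<And>i. xarc X f (p i) (p (i + 1)) \<noteq> {}" "\<And>i. yarc Y f (p (i + 1)) (p i) \<noteq> {}"
    using loop by (auto simp: infty_homoclinic_loop_def)
  have lip: "lip_field X" "lip_field Y" "lip_field f"
    using Z by (auto simp: psvf_def intro: smooth_field_lip smooth2_lip)
  have fp: "f (p i) = 0" "lie f X (p i) = 0" "lie f Y (p i) = 0" for i
    using fold[of i] by (auto simp: vv_two_fold_def visible_fold_X_def visible_fold_Y_def)
  define F where "F i = yarc Y f (p (i + 1)) (p i)" for i
  \<comment> \<open>The shift by one arises because \<open>F j\<close> runs from
    \<open>p (j + 1)\<close> to \<open>p j\<close>: the arc starting at \<open>q i = p (- i)\<close>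
    has \<open>j = - i - 1\<close>.\<close>
  have qarc: "xarc Y (\<lambda>z. - f z) (q i) (q (i + 1)) = F (- i - 1)" for i
  proof -
    have "- i = - i - 1 + 1" "- (i + 1) = - i - 1" by simp_all
    then show ?thesis unfolding F_def yarc_eq_xarc q_def by metis
  qed
  have B: "B = (\<Union>i. yarc Y f (p (i + 1)) (p i))"
  proof -
    have "surj (\<lambda>i::int. - i - 1)" by (rule surjI[where f = "\<lambda>i. - i - 1"]) simp
    then have "(\<Union>i. F (- i - 1)) = (\<Union>i. F i)" by (metis image_image)
    then show ?thesis unfolding B_def qarc F_def .
  qed
  have LAB: "loop_set X Y f p = A \<union> B" unfolding loop_set_def A_def B by blast
  obtain a b where a: "orbit_param X A a b" "\<And>i. a (of_int i) = p i"
    "\<And>z. z \<in> A \<Longrightarrow> f z \<ge> 0" "\<And>z. z \<in> A \<Longrightarrow> f z = 0 \<Longrightarrow> z \<in> range p"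
    using arc_chain_param[OF lip(1) inj fp(1) ne(1) A_def] by blast
  have "inj q" by (rule injI) (use injD[OF inj] in \<open>force simp: q_def\<close>)
  moreover have "- f (q i) = 0" for i by (simp add: q_def fp)
  moreover have "xarc Y (\<lambda>z. - f z) (q i) (q (i + 1)) \<noteq> {}" for i
    unfolding qarc F_def by (rule ne(2))
  ultimately obtain c d where c: "orbit_param Y B c d" "\<And>i. c (of_int i) = q i"
    "\<And>z. z \<in> B \<Longrightarrow> - f z \<ge> 0" "\<And>z. z \<in> B \<Longrightarrow> - f z = 0 \<Longrightarrow> z \<in> range q"
    using arc_chain_param[OF lip(2) _ _ _ B_def] by blast
  have pA: "p i \<in> A" for i using orbit_paramD(3)[OF a(1)] a(2) by metis
  have pB: "p i \<in> B" for i using orbit_paramD(3)[OF c(1), of "of_int (- i)"] c(2)[of "- i"] by (simp add: q_def)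
  \<comment> \<open>A lower point with \<open>f z \<ge> 0\<close> is a zero of \<open>f\<close>,
    hence a two-fold, and two-folds lie on both orbits. So the sign of \<open>f\<close> alone cuts
    the loop into its two orbits.\<close>
  have BA: "z \<in> A" if "z \<in> B" "f z \<ge> 0" for z
  proof -
    have "z \<in> range q" using c(3,4)[OF that(1)] that(2) by simp
    then show ?thesis using pA by (auto simp: q_def)
  qed
  have AB: "z \<in> B" if "z \<in> A" "f z \<le> 0" for z
  proof -
    have "z \<in> range p" using a(3,4)[OF that(1)] that(2) by simp
    then show ?thesis using pB by auto
  qed
  have up: "loop_set X Y f p \<inter> {z. f z \<ge> 0} = A"
    unfolding LAB using a(3) BA by blast
  have low: "loop_set X Y f p \<inter> {z. f z \<le> 0} = B"
  proof -
    have "f z \<le> 0" if "z \<in> B" for z using c(3)[OF that] by simp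
    then show ?thesis unfolding LAB using AB by blast
  qed
  have \<Sigma>: "loop_set X Y f p \<inter> {z. f z = 0} = range (\<lambda>i::int. a (of_int i))"
  proof
    show "loop_set X Y f p \<inter> {z. f z = 0} \<subseteq> range (\<lambda>i::int. a (of_int i))"
    proof
      fix z assume z: "z \<in> loop_set X Y f p \<inter> {z. f z = 0}"
      then have "z \<in> A" "f z = 0" using up by auto
      then show "z \<in> range (\<lambda>i::int. a (of_int i))" unfolding a(2) by (rule a(4))
    qed
    show "range (\<lambda>i::int. a (of_int i)) \<subseteq> loop_set X Y f p \<inter> {z. f z = 0}"
      unfolding a(2) LAB using pA fp(1) by blast
  qed
  have "loop_set X Y f p \<inter> sliding_or_escaping X Y f = {}"
  proof -
    have "False" if z: "z \<in> loop_set X Y f p" "z \<in> sliding_or_escaping X Y f" for z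
    proof -
      have "f z = 0" using z by (auto simp: sliding_or_escaping_def)
      then obtain i :: int where "z = a (of_int i)" using \<Sigma> z by blast
      then have "z = p i" by (simp add: a(2))
      then show False using z(2) by (simp add: sliding_or_escaping_def fp)
    qed
    then show ?thesis by blast
  qed
  moreover have "a (of_int i) = c (- of_int i)" for i
    using c(2)[of "- i"] by (simp add: a(2) q_def)
  ultimately show thesis
    using a(1) c(1) lip_field_continuous[OF lip(3)] \<Sigma>
    by (intro that[of a b c d]) (simp add: loop_param_def up low)
qed

theorem theoremB:
  fixes X' Y' :: "pt \<Rightarrow> pt" and f' :: "pt \<Rightarrow> real" and p :: "int \<Rightarrow> pt"
  assumes "psvf X' Y' f'"
    and "infty_homoclinic_loop X' Y' f' p"
  shows "sigma_equiv X_inf Y_inf f_inf Lambda_inf X' Y' f' (loop_set X' Y' f' p)"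
  using loop_loop_param[OF assms] loop_param_sigma_equiv[OF model_loop_param] by metis

end
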